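(* The cycle ranks of $Q_0,Q_1,Q_2,Q_3$ are $0,0,1,5$, respectively. Hence $$\pi_1(Q_2)\cong\mathbb Z,\qquad \pi_1(Q_3)\cong F_5.$$ Thus $Q_3$ is the first hypercube whose reduced loop words can be noncommutative; that is, $\pi_1(Q_d)$ is abelian for $d=0,1,2$, while $\pi_1(Q_3)$ is nonabelian.
   Context: $Q_d$ denotes the $1$-skeleton (graph) of the $d$-dimensional cube: vertex set $\{0,1\}^d$, with two vertices adjacent iff they differ in exactly one coordinate. The cycle rank of a finite connected graph with vertex set $V$ and edge set $E$ is $|E|-|V|+1$. $\pi_1(Q_d)$ is the fundamental group of this graph (as a $1$-dimensional complex), whose elements are represented by reduced loop words in the edges outside a chosen spanning tree; $F_5$ is the free group of rank $5$. *)

theory Defs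
  imports "HOL-Analysis.Analysis" "HOL-Algebra.Elementary_Groups"
begin

definition cube_vertices :: "nat \<Rightarrow> bool list set" where
  "cube_vertices d = {v. length v = d}"

definition cube_edges :: "nat \<Rightarrow> bool list set set" where
  "cube_edges d = {{u, v} | u v. u \<in> cube_vertices d \<and> v \<in> cube_vertices d
                                \<and> card {i. i < d \<and> u ! i \<noteq> v ! i} = 1}"

text \<open>The difference is taken in the integers, to avoid truncated subtraction.\<close>

definition cycle_rank :: "'v set \<Rightarrow> 'v set set \<Rightarrow> int" where
  "cycle_rank V E = int (card E) - int (card V) + 1"

text \<open>The geometric realization of a simple graph as a one-dimensional simplicial complex, in
  barycentric coordinates: a point is a convex combination of vertices whose support is a vertex
  or an edge. The ambient type carries the product topology, so for a finite graph the subspace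
  topology is the usual topology of the complex.\<close>

definition graph_realization :: "'v set \<Rightarrow> 'v set set \<Rightarrow> ('v \<Rightarrow> real) set" where
  "graph_realization V E =
     {x. (\<forall>v. 0 \<le> x v) \<and> {v. x v \<noteq> 0} \<in> (\<lambda>v. {v}) ` V \<union> E \<and> (\<Sum>v | x v \<noteq> 0. x v) = 1}"

definition hypercube :: "nat \<Rightarrow> (bool list \<Rightarrow> real) set" where
  "hypercube d = graph_realization (cube_vertices d) (cube_edges d)"

definition loops_at :: "'a::topological_space set \<Rightarrow> 'a \<Rightarrow> (real \<Rightarrow> 'a) set" where
  "loops_at S a = {p. path p \<and> path_image p \<subseteq> S \<and> pathstart p = a \<and> pathfinish p = a}"

definition loop_homotopy :: "'a::topological_space set \<Rightarrow> 'a \<Rightarrow> ((real \<Rightarrow> 'a) \<times> (real \<Rightarrow> 'a)) set" where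
  "loop_homotopy S a = {(p, q). p \<in> loops_at S a \<and> q \<in> loops_at S a \<and> homotopic_paths S p q}"

definition fundamental_group :: "'a::topological_space set \<Rightarrow> 'a \<Rightarrow> (real \<Rightarrow> 'a) set monoid" where
  "fundamental_group S a =
     \<lparr>carrier = loops_at S a // loop_homotopy S a,
      mult = (\<lambda>A B. \<Union>p\<in>A. \<Union>q\<in>B. loop_homotopy S a `` {p +++ q}),
      one = loop_homotopy S a `` {\<lambda>_. a}\<rparr>"

text \<open>The letter \<open>(x, True)\<close> stands for the generator \<open>x\<close>, and \<open>(x, False)\<close> for its inverse.\<close>

definition inv_letter :: "'a \<times> bool \<Rightarrow> 'a \<times> bool" where
  "inv_letter l = (fst l, \<not> snd l)"

definition reduced_word :: "('a \<times> bool) list \<Rightarrow> bool" where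
  "reduced_word w \<longleftrightarrow> (\<forall>i. Suc i < length w \<longrightarrow> w ! Suc i \<noteq> inv_letter (w ! i))"

text \<open>Left multiplication of a reduced word by a letter, keeping it reduced.\<close>

definition cons_letter :: "'a \<times> bool \<Rightarrow> ('a \<times> bool) list \<Rightarrow> ('a \<times> bool) list" where
  "cons_letter l w = (if w \<noteq> [] \<and> hd w = inv_letter l then tl w else l # w)"

definition free_group :: "'a set \<Rightarrow> ('a \<times> bool) list monoid" where
  "free_group X =
     \<lparr>carrier = {w. fst ` set w \<subseteq> X \<and> reduced_word w},
      mult = (\<lambda>u w. foldr cons_letter u w),
      one = []\<rparr>"

end

theory Submission
  imports Defs
begin

text \<open>
  The statement is a special case of a theorem about graphs: the fundamental group of the realization
  of a graph with a spanning tree is free on the edges outside the tree (the chords)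
  (\<open>fundamental_group_iso_free_group\<close>), and for a finite graph the number of chords is the cycle rank
  (\<open>cycle_rank_eq_card_chords\<close>). For the cube \<open>Q\<^sub>d\<close> the tree
  joins each nonzero vertex to the vertex obtained by clearing its first coordinate that is set.
  The chords of \<open>Q\<^sub>0\<close>, \<open>Q\<^sub>1\<close>, \<open>Q\<^sub>2\<close>, \<open>Q\<^sub>3\<close> can then be listed: there are 0, 0, 1 and 5 of them
  (\<open>cube_chords_0\<close> to \<open>cube_chords_3\<close>). A free group on one generator is infinite cyclic, and one on
  two or more generators is not commutative.

  The isomorphism of the fundamental group with the free group on the chords
  (\<open>fundamental_group_root_iso\<close>) is constructed without covering spaces or the theorem of van Kampen.
  The open stars of the vertices cover the realization, and no point lies in three of them. Hence
  any assignment of group elements \<open>g u v\<close> to the oriented edges, with \<open>g v u\<close> inverse to \<open>g u v\<close>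
  and \<open>g v v = \<one>\<close>, is a cocycle for this cover, and a cocycle has a holonomy. A flat section along a map \<open>f\<close> gives at
  each point \<open>z\<close> and for each star that contains \<open>f z\<close> a group element \<open>c z v\<close>; it is locally constant
  in \<open>z\<close> and satisfies \<open>c z v = c z u \<otimes> g u v\<close> on overlaps. Such sections exist along every map from a
  square (\<open>flat_section_exists_square\<close>) and are unique up to left translation on connected domains
  (\<open>flat_section_unique\<close>). So comparing the values of a flat section at the two ends of a path gives a
  homotopy invariant that is multiplicative, \<open>transport\<close>.

  Two cocycles are used. The first takes values in the free group: it labels a chord by its letter
  and a tree edge by the empty word; its transport is a homomorphism \<open>\<phi>\<close> from the fundamental group
  to the free group. The second takes values in the fundamental group itself: it labels the edge
  \<open>u v\<close> by the class of the loop that follows the tree to \<open>u\<close>, crosses the edge, and returns from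
  \<open>v\<close> through the tree. The homomorphism \<open>\<psi>\<close> (\<open>class_of_word\<close>) that sends each chord to this class
  turns the first cocycle into the second. The transport of a loop for the second cocycle is the
  class of that loop (\<open>transport_loop\<close>), since the class of the loop that runs along \<open>p\<close> up to time
  \<open>t\<close>, then straight to a vertex \<open>v\<close> whose star contains \<open>p t\<close>, then back through the tree, is a flat
  section. Therefore \<open>\<psi> \<circ> \<phi>\<close> is the identity. In the other direction \<open>\<phi> \<circ> \<psi>\<close> fixes every generator,
  hence is the identity.
\<close>

section \<open>Homotopies of paths in topological spaces\<close>

text \<open>Two paths with the same endpoints that factor through one map on a convex set are homotopic. The
  laws for units, inverses and subdivision, and the contraction of an open star, are instances.\<close>

lemma homotopic_paths_convex_image:
  fixes F :: "'a::real_normed_vector \<Rightarrow> 'b::topological_space"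
  assumes "convex C" "continuous_on C F" "F \<in> C \<rightarrow> S"
    and "path \<gamma>" "path_image \<gamma> \<subseteq> C" "path \<delta>" "path_image \<delta> \<subseteq> C"
    and "pathstart \<gamma> = pathstart \<delta>" "pathfinish \<gamma> = pathfinish \<delta>"
  shows "homotopic_paths S (F \<circ> \<gamma>) (F \<circ> \<delta>)"
proof (rule homotopic_paths_continuous_image)
  show "homotopic_paths C \<gamma> \<delta>"
  proof (rule homotopic_paths_linear)
    show "closed_segment (\<gamma> t) (\<delta> t) \<subseteq> C" if "t \<in> {0..1}" for t
      using that assms by (intro closed_segment_subset) (auto simp: path_image_def)
  qed (use assms in auto)
qed (use assms in auto)

text \<open>A path \<open>p\<close> run along \<open>[s, t]\<close> is \<open>p \<circ> linepath s t\<close>.\<close>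

lemma path_restrict [simp]:
  assumes "path p" "s \<in> {0..1}" "t \<in> {0..1}"
  shows "path (p \<circ> linepath s t)"
proof (rule path_continuous_image)
  show "continuous_on (path_image (linepath s t)) p"
    using assms by (auto simp: path_def closed_segment_eq_real_ivl
      elim!: continuous_on_subset split: if_splits)
qed simp

lemma path_image_restrict:
  assumes "path_image p \<subseteq> S" "s \<in> {0..1}" "t \<in> {0..1}"
  shows "path_image (p \<circ> linepath s t) \<subseteq> S"
proof -
  have "path_image (linepath s t) \<subseteq> {0..1}"
    using assms by (auto simp: closed_segment_eq_real_ivl split: if_splits)
  with assms(1) show ?thesis
    by (auto simp: path_image_compose path_image_def[of p])
qed

lemma comp_linepath_0_1 [simp]: "p \<circ> linepath 0 (1::real) = p"
  by (auto simp: linepath_def)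

lemma comp_linepath_const [simp]: "p \<circ> linepath s s = (\<lambda>_. p s)"
  by (auto simp: linepath_def algebra_simps)

lemma homotopic_paths_restrict_join:
  assumes "path p" "path_image p \<subseteq> S" "s \<in> {0..1}" "t \<in> {0..1}" "u \<in> {0..1}"
  shows "homotopic_paths S ((p \<circ> linepath s t) +++ (p \<circ> linepath t u)) (p \<circ> linepath s u)"
proof -
  have seg: "path_image (linepath s t) \<subseteq> {0..1}" if "s \<in> {0..1}" "t \<in> {0..1}" for s t :: real
    using that by (auto simp: closed_segment_eq_real_ivl split: if_splits)
  have "homotopic_paths S (p \<circ> (linepath s t +++ linepath t u)) (p \<circ> linepath s u)"
  proof (rule homotopic_paths_convex_image[of "{0..1}"])
    show "path_image (linepath s t +++ linepath t u) \<subseteq> {0..1}" "path_image (linepath s u) \<subseteq> {0..1}"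
      using assms by (intro subset_path_image_join seg; simp)+
  qed (use assms in \<open>auto simp: path_def[of p] path_image_def[of p]\<close>)
  then show ?thesis
    by (simp add: path_compose_join)
qed

text \<open>The groupoid laws for paths in an arbitrary topological space. The constant path at \<open>a\<close> is written
  \<open>\<lambda>_. a\<close>, because \<open>linepath a a\<close> makes sense in a normed space only.\<close>

lemma homotopic_paths_join_const:
  assumes "path p" "path_image p \<subseteq> S"
  shows "homotopic_paths S (p +++ (\<lambda>_. pathfinish p)) p"
  using homotopic_paths_restrict_join[OF assms, of 0 1 1] by (simp add: pathfinish_def)

lemma homotopic_paths_const_join:
  assumes "path p" "path_image p \<subseteq> S"
  shows "homotopic_paths S ((\<lambda>_. pathstart p) +++ p) p"
  using homotopic_paths_restrict_join[OF assms, of 0 0 1] by (simp add: pathstart_def)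

lemma comp_linepath_1_0: "p \<circ> linepath (1::real) 0 = reversepath p"
  by (auto simp: linepath_def reversepath_def)

lemma homotopic_paths_join_reverse:
  assumes "path p" "path_image p \<subseteq> S"
  shows "homotopic_paths S (p +++ reversepath p) (\<lambda>_. pathstart p)"
  using homotopic_paths_restrict_join[OF assms, of 0 1 0]
  by (simp add: pathstart_def comp_linepath_1_0)

lemma homotopic_paths_cancel:
  assumes p: "path p" "path_image p \<subseteq> S" and q: "path q" "path_image q \<subseteq> S"
    and "pathfinish p = pathstart q"
  shows "homotopic_paths S (reversepath p +++ (p +++ q)) q"
proof -
  have "homotopic_paths S (reversepath p +++ (p +++ q)) ((reversepath p +++ p) +++ q)"
    using assms by (intro homotopic_paths_assoc) auto
  also have "homotopic_paths S \<dots> ((\<lambda>_. pathstart q) +++ q)"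
    using homotopic_paths_join_reverse[of "reversepath p" S] assms
    by (intro homotopic_paths_join) auto
  also have "homotopic_paths S \<dots> q"
    using q by (rule homotopic_paths_const_join)
  finally show ?thesis .
qed

text \<open>The path \<open>p\<close>, then \<open>q\<close>, then \<open>t\<close> backwards. With \<open>p\<close> and \<open>t\<close> starting at a base point, this
  is the loop that \<open>q\<close> defines by means of \<open>p\<close> and \<open>t\<close>.\<close>

definition sandwich :: "(real \<Rightarrow> 'a::topological_space) \<Rightarrow> (real \<Rightarrow> 'a) \<Rightarrow> (real \<Rightarrow> 'a) \<Rightarrow> real \<Rightarrow> 'a" where
  "sandwich p q t = p +++ (q +++ reversepath t)"

text \<open>\<open>p\<close> is a path in \<open>S\<close> from \<open>x\<close> to \<open>y\<close>.\<close>

definition path_in :: "'a::topological_space set \<Rightarrow> 'a \<Rightarrow> 'a \<Rightarrow> (real \<Rightarrow> 'a) \<Rightarrow> bool" where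
  "path_in S x y p \<longleftrightarrow> path p \<and> path_image p \<subseteq> S \<and> pathstart p = x \<and> pathfinish p = y"

lemma path_in_join: "path_in S x y p \<Longrightarrow> path_in S y z q \<Longrightarrow> path_in S x z (p +++ q)"
  using subset_path_image_join[of p S q] by (auto simp: path_in_def)

lemma path_in_reverse: "path_in S x y p \<Longrightarrow> path_in S y x (reversepath p)"
  by (auto simp: path_in_def)

lemma path_in_const: "x \<in> S \<Longrightarrow> path_in S x x (\<lambda>_. x)"
  by (auto simp: path_in_def path_def path_image_def pathstart_def pathfinish_def)

lemma path_in_restrict:
  assumes "path_in S x y p" "s \<in> {0..1}" "t \<in> {0..1}"
  shows "path_in S (p s) (p t) (p \<circ> linepath s t)"
  using assms path_image_restrict[of p S s t]
  by (auto simp: path_in_def pathstart_compose pathfinish_compose)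

lemma path_in_sandwich:
  "path_in S w x p \<Longrightarrow> path_in S x y q \<Longrightarrow> path_in S z y t \<Longrightarrow> path_in S w z (sandwich p q t)"
  unfolding sandwich_def by (intro path_in_join path_in_reverse)

lemma homotopic_refl_path_in: "path_in S x y p \<Longrightarrow> homotopic_paths S p p"
  by (simp add: path_in_def)

lemma homotopic_join_path_in:
  "homotopic_paths S p p' \<Longrightarrow> homotopic_paths S q q' \<Longrightarrow> path_in S x y p \<Longrightarrow> path_in S y z q
    \<Longrightarrow> homotopic_paths S (p +++ q) (p' +++ q')"
  by (rule homotopic_paths_join) (auto simp: path_in_def)

lemma homotopic_assoc_path_in:
  "path_in S w x p \<Longrightarrow> path_in S x y q \<Longrightarrow> path_in S y z r
    \<Longrightarrow> homotopic_paths S ((p +++ q) +++ r) (p +++ (q +++ r))"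
  by (rule homotopic_paths_sym, rule homotopic_paths_assoc) (auto simp: path_in_def)

lemma homotopic_cancel_path_in:
  assumes "path_in S x y p" "path_in S y z q"
  shows "homotopic_paths S (reversepath p +++ (p +++ q)) q"
  using assms by (intro homotopic_paths_cancel) (auto simp: path_in_def)

lemma homotopic_paths_sandwich:
  assumes "homotopic_paths S p p'" "homotopic_paths S q q'"
    and "path_in S w x p" "path_in S x y q" "path_in S z y t"
  shows "homotopic_paths S (sandwich p q t) (sandwich p' q' t)"
  unfolding sandwich_def
  using assms
  by (meson homotopic_join_path_in homotopic_refl_path_in path_in_join path_in_reverse)

lemma sandwich_join_sandwich:
  assumes p: "path_in S a x p" and q: "path_in S x y q" and t: "path_in S b y t"
    and q': "path_in S y z q'" and t': "path_in S c z t'"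
    and h: "homotopic_paths S (q +++ q') r"
  shows "homotopic_paths S (sandwich p q t +++ sandwich t q' t') (sandwich p r t')"
proof -
  note tr = path_in_reverse[OF t] path_in_reverse[OF t']
  note [intro] = path_in_join p q t q' t' tr
  have "homotopic_paths S (sandwich p q t +++ sandwich t q' t')
      (p +++ ((q +++ reversepath t) +++ (t +++ (q' +++ reversepath t'))))"
    unfolding sandwich_def by (rule homotopic_assoc_path_in; blast)
  also have "homotopic_paths S \<dots> (p +++ (r +++ reversepath t'))"
  proof (rule homotopic_join_path_in)
    have "homotopic_paths S ((q +++ reversepath t) +++ (t +++ (q' +++ reversepath t')))
       (q +++ (reversepath t +++ (t +++ (q' +++ reversepath t'))))"
      by (rule homotopic_assoc_path_in; blast)
    also have "homotopic_paths S \<dots> (q +++ (q' +++ reversepath t'))"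
    proof (rule homotopic_join_path_in)
      show "homotopic_paths S (reversepath t +++ (t +++ (q' +++ reversepath t'))) (q' +++ reversepath t')"
        by (rule homotopic_cancel_path_in; blast)
    qed (use homotopic_refl_path_in in blast)+
    also have "homotopic_paths S \<dots> ((q +++ q') +++ reversepath t')"
      by (rule homotopic_paths_sym, rule homotopic_assoc_path_in; blast)
    also have "homotopic_paths S \<dots> (r +++ reversepath t')"
    proof (rule homotopic_join_path_in[OF h])
    qed (use homotopic_refl_path_in in blast)+
    finally show "homotopic_paths S ((q +++ reversepath t) +++ (t +++ (q' +++ reversepath t')))
       (r +++ reversepath t')" .
  qed (use homotopic_refl_path_in in blast)+
  finally show ?thesis
    by (simp add: sandwich_def)
qed

text \<open>A piece \<open>q\<close> of the path may be moved from the first factor of a sandwich to the second.\<close>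

lemma sandwich_absorb:
  assumes p: "path_in S a x p" and q: "path_in S x y q" and r: "path_in S y z r"
    and t: "path_in S b z t"
    and h: "homotopic_paths S (p +++ q) p'" and k: "homotopic_paths S (q +++ r) r'"
  shows "homotopic_paths S (sandwich p' r t) (sandwich p r' t)"
proof -
  note [intro] = path_in_join p q r t path_in_reverse[OF t]
  have "homotopic_paths S (p' +++ (r +++ reversepath t)) ((p +++ q) +++ (r +++ reversepath t))"
    by (rule homotopic_paths_sym, rule homotopic_join_path_in[OF h])
       (use homotopic_refl_path_in in blast)+
  also have "homotopic_paths S \<dots> (p +++ (q +++ (r +++ reversepath t)))"
    by (rule homotopic_assoc_path_in; blast)
  also have "homotopic_paths S \<dots> (p +++ (r' +++ reversepath t))"
  proof (rule homotopic_join_path_in)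
    have "homotopic_paths S (q +++ (r +++ reversepath t)) ((q +++ r) +++ reversepath t)"
      by (rule homotopic_paths_sym, rule homotopic_assoc_path_in; blast)
    also have "homotopic_paths S \<dots> (r' +++ reversepath t)"
      by (rule homotopic_join_path_in[OF k]) (use homotopic_refl_path_in in blast)+
    finally show "homotopic_paths S (q +++ (r +++ reversepath t)) (r' +++ reversepath t)" .
  qed (use homotopic_refl_path_in in blast)+
  finally show ?thesis
    by (simp add: sandwich_def)
qed

lemma sandwich_reverse_cancel:
  assumes q: "path_in S a a q" and t: "path_in S a b t"
  shows "homotopic_paths S (sandwich t (sandwich (reversepath t) q (reversepath t)) t) q"
proof -
  note [intro] = path_in_join q t path_in_reverse[OF t]
  let ?u = "reversepath t"
  have "homotopic_paths S (t +++ ((?u +++ (q +++ t)) +++ ?u)) (t +++ (?u +++ ((q +++ t) +++ ?u)))"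
    by (rule homotopic_join_path_in, rule homotopic_refl_path_in, blast,
        rule homotopic_assoc_path_in; blast)
  also have "homotopic_paths S \<dots> ((q +++ t) +++ ?u)"
    using homotopic_cancel_path_in[of S b a ?u a "(q +++ t) +++ ?u"]
    by simp blast
  also have "homotopic_paths S \<dots> (q +++ (t +++ ?u))"
    by (rule homotopic_assoc_path_in; blast)
  also have "homotopic_paths S \<dots> (q +++ (\<lambda>_. a))"
    using homotopic_paths_join_reverse[of t S] q t
    by (intro homotopic_paths_join) (auto simp: path_in_def)
  also have "homotopic_paths S \<dots> q"
    using homotopic_paths_join_const[of q S] q by (auto simp: path_in_def)
  finally show ?thesis
    by (simp add: sandwich_def)
qed

section \<open>The fundamental group\<close>

text \<open>The element of the fundamental group that a loop \<open>p\<close> at \<open>a\<close> represents.\<close>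

definition loop_class :: "'a::topological_space set \<Rightarrow> 'a \<Rightarrow> (real \<Rightarrow> 'a) \<Rightarrow> (real \<Rightarrow> 'a) set" where
  "loop_class S a p = loop_homotopy S a `` {p}"

lemma loops_at_iff: "p \<in> loops_at S a \<longleftrightarrow> path_in S a a p"
  by (auto simp: loops_at_def path_in_def)

lemma equiv_loop_homotopy: "equiv (loops_at S a) (loop_homotopy S a)"
proof (rule equivI)
  show "loop_homotopy S a \<subseteq> loops_at S a \<times> loops_at S a"
    by (auto simp: loop_homotopy_def)
  show "refl_on (loops_at S a) (loop_homotopy S a)"
    by (auto simp: refl_on_def loop_homotopy_def loops_at_def)
  show "sym (loop_homotopy S a)"
    by (auto simp: sym_def loop_homotopy_def homotopic_paths_sym)
  show "trans (loop_homotopy S a)"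
    by (auto simp: trans_def loop_homotopy_def intro: homotopic_paths_trans)
qed

lemma loop_class_eq_iff:
  "path_in S a a p \<Longrightarrow> path_in S a a q
    \<Longrightarrow> loop_class S a p = loop_class S a q \<longleftrightarrow> homotopic_paths S p q"
  unfolding loop_class_def
  by (subst eq_equiv_class_iff[OF equiv_loop_homotopy]) (auto simp: loops_at_iff loop_homotopy_def)

lemma loop_class_eqI:
  assumes "path_in S a a p" "homotopic_paths S p q"
  shows "loop_class S a p = loop_class S a q"
proof (subst loop_class_eq_iff)
  show "path_in S a a q"
    using assms homotopic_paths_imp_path homotopic_paths_imp_subset
      homotopic_paths_imp_pathstart homotopic_paths_imp_pathfinish
    unfolding path_in_def by metis
qed (use assms in auto)

lemma carrier_fundamental_group:
  "carrier (fundamental_group S a) = loop_class S a ` {p. path_in S a a p}"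
  by (auto simp: fundamental_group_def quotient_def loop_class_def loops_at_iff)

lemma loop_class_in_carrier [simp]:
  "path_in S a a p \<Longrightarrow> loop_class S a p \<in> carrier (fundamental_group S a)"
  by (auto simp: carrier_fundamental_group)

lemma mult_fundamental_group:
  assumes "path_in S a a p" "path_in S a a q"
  shows "loop_class S a p \<otimes>\<^bsub>fundamental_group S a\<^esub> loop_class S a q = loop_class S a (p +++ q)"
proof -
  have "loop_class S a (p' +++ q') = loop_class S a (p +++ q)"
    if "p' \<in> loop_class S a p" "q' \<in> loop_class S a q" for p' q'
  proof (rule loop_class_eqI[symmetric])
    show "homotopic_paths S (p +++ q) (p' +++ q')"
      using that assms by (intro homotopic_join_path_in) (auto simp: loop_class_def loop_homotopy_def)
  qed (use assms path_in_join in blast)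
  moreover have "loop_class S a p \<noteq> {}" "loop_class S a q \<noteq> {}"
    using assms equiv_class_self[OF equiv_loop_homotopy] by (auto simp: loop_class_def loops_at_iff)
  ultimately have "(\<Union>p'\<in>loop_class S a p. \<Union>q'\<in>loop_class S a q. loop_class S a (p' +++ q'))
      = loop_class S a (p +++ q)"
    by simp
  then show ?thesis
    by (simp add: fundamental_group_def flip: loop_class_def)
qed

lemma one_fundamental_group: "\<one>\<^bsub>fundamental_group S a\<^esub> = loop_class S a (\<lambda>_. a)"
  by (simp add: fundamental_group_def loop_class_def)

lemma loop_class_one: 
  "a \<in> S \<Longrightarrow> path_in S a a p \<Longrightarrow> homotopic_paths S p (\<lambda>_. a)
    \<Longrightarrow> loop_class S a p = \<one>\<^bsub>fundamental_group S a\<^esub>"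
  by (simp add: one_fundamental_group loop_class_eqI)

lemma group_fundamental_group:
  assumes "a \<in> S"
  shows "group (fundamental_group S a)"
proof (rule groupI)
  show "\<one>\<^bsub>fundamental_group S a\<^esub> \<in> carrier (fundamental_group S a)"
    using assms by (simp add: one_fundamental_group path_in_const)
next
  fix x y assume "x \<in> carrier (fundamental_group S a)" "y \<in> carrier (fundamental_group S a)"
  then show "x \<otimes>\<^bsub>fundamental_group S a\<^esub> y \<in> carrier (fundamental_group S a)"
    by (auto simp: carrier_fundamental_group mult_fundamental_group intro: path_in_join)
next
  fix x y z assume "x \<in> carrier (fundamental_group S a)" "y \<in> carrier (fundamental_group S a)"
    "z \<in> carrier (fundamental_group S a)"
  then obtain p q r where
    [simp]: "x = loop_class S a p" "y = loop_class S a q" "z = loop_class S a r" and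
    [intro]: "path_in S a a p" "path_in S a a q" "path_in S a a r"
    by (auto simp: carrier_fundamental_group)
  have "loop_class S a ((p +++ q) +++ r) = loop_class S a (p +++ (q +++ r))"
    by (intro loop_class_eqI homotopic_assoc_path_in path_in_join) auto
  then show "x \<otimes>\<^bsub>fundamental_group S a\<^esub> y \<otimes>\<^bsub>fundamental_group S a\<^esub> z
      = x \<otimes>\<^bsub>fundamental_group S a\<^esub> (y \<otimes>\<^bsub>fundamental_group S a\<^esub> z)"
    by (simp add: mult_fundamental_group path_in_join[of S a a p a q] path_in_join[of S a a q a r]
          \<open>path_in S a a p\<close> \<open>path_in S a a q\<close> \<open>path_in S a a r\<close>)
next
  fix x assume "x \<in> carrier (fundamental_group S a)"
  then obtain p where p: "x = loop_class S a p" "path_in S a a p"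
    by (auto simp: carrier_fundamental_group)
  note c = path_in_const[OF assms]
  have "loop_class S a ((\<lambda>_. a) +++ p) = loop_class S a p"
    using homotopic_paths_const_join[of p S] p c
    by (intro loop_class_eqI path_in_join) (auto simp: path_in_def)
  then show "\<one>\<^bsub>fundamental_group S a\<^esub> \<otimes>\<^bsub>fundamental_group S a\<^esub> x = x"
    using p c by (simp add: one_fundamental_group mult_fundamental_group)
  have "loop_class S a (reversepath p +++ p) = \<one>\<^bsub>fundamental_group S a\<^esub>"
    using homotopic_paths_join_reverse[of "reversepath p" S] p
    by (intro loop_class_one path_in_join path_in_reverse assms) (auto simp: path_in_def)
  then show "\<exists>y\<in>carrier (fundamental_group S a).
      y \<otimes>\<^bsub>fundamental_group S a\<^esub> x = \<one>\<^bsub>fundamental_group S a\<^esub>"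
    using p path_in_reverse[of S a a p]
    by (intro bexI[of _ "loop_class S a (reversepath p)"]) (auto simp: mult_fundamental_group)
qed

text \<open>A function on loops that is invariant under homotopy, as a function on classes.\<close>

definition on_classes :: "((real \<Rightarrow> 'a) \<Rightarrow> 'b) \<Rightarrow> (real \<Rightarrow> 'a) set \<Rightarrow> 'b" where
  "on_classes f X = f (SOME p. p \<in> X)"

lemma on_classes_loop_class:
  assumes "\<And>q. path_in S a a q \<Longrightarrow> homotopic_paths S p q \<Longrightarrow> f q = f p" and "path_in S a a p"
  shows "on_classes f (loop_class S a p) = f p"
proof -
  have "p \<in> loop_class S a p"
    using assms(2) equiv_class_self[OF equiv_loop_homotopy] by (auto simp: loop_class_def loops_at_iff)
  then have "(SOME q. q \<in> loop_class S a p) \<in> loop_class S a p"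
    by (metis someI)
  then show ?thesis
    using assms(1) by (auto simp: on_classes_def loop_class_def loop_homotopy_def loops_at_iff)
qed

lemma fundamental_group_change_basepoint:
  assumes t: "path_in S b a t"
  shows "fundamental_group S a \<cong> fundamental_group S b"
proof -
  define M where "M b t = on_classes (\<lambda>p. loop_class S b (sandwich t p t))"
    for t :: "real \<Rightarrow> 'a" and b
  have M: "M b t (loop_class S a p) = loop_class S b (sandwich t p t)"
    if t: "path_in S b a t" and p: "path_in S a a p" for a b t p
    unfolding M_def
  proof (rule on_classes_loop_class[OF _ p])
    fix q assume q: "path_in S a a q" "homotopic_paths S p q"
    show "loop_class S b (sandwich t q t) = loop_class S b (sandwich t p t)"
      by (rule loop_class_eqI[OF path_in_sandwich[OF t q(1) t]],
          rule homotopic_paths_sandwich[OF homotopic_refl_path_in[OF t] _ t q(1) t])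
         (rule homotopic_paths_sym[OF q(2)])
  qed
  have inverse: "M b t (M a (reversepath t) (loop_class S b p)) = loop_class S b p"
    if "path_in S b a t" "path_in S b b p" for a b t p
    using that path_in_sandwich[of S a b "reversepath t" b p a "reversepath t"]
    by (auto simp: M path_in_reverse intro!: loop_class_eqI sandwich_reverse_cancel path_in_sandwich)
  have hom: "M b t \<in> hom (fundamental_group S a) (fundamental_group S b)"
  proof (rule homI)
    fix x y assume "x \<in> carrier (fundamental_group S a)" "y \<in> carrier (fundamental_group S a)"
    then obtain p q where
      [simp]: "x = loop_class S a p" "y = loop_class S a q" and
      pq: "path_in S a a p" "path_in S a a q"
      by (auto simp: carrier_fundamental_group)
    have "loop_class S b (sandwich t p t +++ sandwich t q t) = loop_class S b (sandwich t (p +++ q) t)"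
      by (rule loop_class_eqI, (rule path_in_join path_in_sandwich t pq)+, rule sandwich_join_sandwich)
         (rule t pq homotopic_refl_path_in path_in_join)+
    then show "M b t (x \<otimes>\<^bsub>fundamental_group S a\<^esub> y) = M b t x \<otimes>\<^bsub>fundamental_group S b\<^esub> M b t y"
      using pq t path_in_sandwich[of S b a t a p b t] path_in_sandwich[of S b a t a q b t]
      by (simp add: mult_fundamental_group M path_in_join[OF pq])
  qed (auto simp: carrier_fundamental_group M t path_in_sandwich[OF t _ t])
  have "bij_betw (M b t) (carrier (fundamental_group S a)) (carrier (fundamental_group S b))"
    using t path_in_sandwich[of S a b "reversepath t" b _ a "reversepath t"]
      path_in_sandwich[of S b a t a _ b t] inverse[of a b "reversepath t"] inverse[OF t]
    by (intro bij_betw_byWitness[of _ "M a (reversepath t)"])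
       (auto simp: carrier_fundamental_group M path_in_reverse)
  with hom show ?thesis
    by (auto simp: is_iso_def iso_def)
qed

section \<open>Free groups of reduced words\<close>

lemma inv_letter_simps [simp]:
  "inv_letter (inv_letter l) = l" "fst (inv_letter l) = fst l" "snd (inv_letter l) = (\<not> snd l)"
  "inv_letter (x, b) = (x, \<not> b)"
  by (auto simp: inv_letter_def)

lemma reduced_word_Nil [simp]: "reduced_word []"
  by (simp add: reduced_word_def)

lemma reduced_word_Cons [simp]:
  "reduced_word (l # w) \<longleftrightarrow> (w = [] \<or> hd w \<noteq> inv_letter l) \<and> reduced_word w"
proof (cases w)
  case (Cons a list)
  then show ?thesis
    unfolding reduced_word_def by (auto simp: nth_Cons' All_less_Suc2 gr0_conv_Suc)
qed (auto simp: reduced_word_def)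

lemma cons_letter_reduced: "reduced_word w \<Longrightarrow> reduced_word (cons_letter l w)"
  by (cases w) (auto simp: cons_letter_def)

lemma cons_letter_inv:
  "reduced_word w \<Longrightarrow> cons_letter l (cons_letter (inv_letter l) w) = w"
  by (cases w; cases "tl w") (auto simp: cons_letter_def)

lemma foldr_cons_letter_reduced: "reduced_word w \<Longrightarrow> reduced_word (foldr cons_letter u w)"
  by (induction u) (auto simp: cons_letter_reduced)

lemma foldr_cons_letter_Nil: "reduced_word u \<Longrightarrow> foldr cons_letter u [] = u"
  by (induction u) (auto simp: cons_letter_def)

text \<open>Multiplying by \<open>cons_letter l u\<close> is multiplying by \<open>u\<close> and then by \<open>l\<close>, also when \<open>l\<close> cancels against
  the head of \<open>u\<close>: in that case \<open>cons_letter l\<close> undoes \<open>cons_letter (inv_letter l)\<close> on reduced words.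
  Associativity follows by induction.\<close>

lemma foldr_cons_letter_cons_letter:
  "reduced_word w \<Longrightarrow> foldr cons_letter (cons_letter l u) w = cons_letter l (foldr cons_letter u w)"
proof (cases "u \<noteq> [] \<and> hd u = inv_letter l")
  case True
  then obtain u' where "u = inv_letter l # u'"
    by (cases u) auto
  moreover assume "reduced_word w"
  ultimately show ?thesis
    by (simp add: cons_letter_inv foldr_cons_letter_reduced cons_letter_def[of l "_ # _"])
qed (auto simp: cons_letter_def[of l u])

lemma foldr_cons_letter_assoc:
  "reduced_word w \<Longrightarrow>
    foldr cons_letter (foldr cons_letter u v) w = foldr cons_letter u (foldr cons_letter v w)"
  by (induction u) (auto simp: foldr_cons_letter_cons_letter)

lemma set_foldr_cons_letter: "set (foldr cons_letter u w) \<subseteq> set u \<union> set w"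
proof (induction u)
  case (Cons l u)
  have "set (cons_letter l v) \<subseteq> insert l (set v)" for v
    by (cases v) (auto simp: cons_letter_def)
  with Cons show ?case
    by fastforce
qed auto

lemma foldr_cons_letter_inverse:
  "foldr cons_letter (rev (map inv_letter u)) u = []"
  by (induction u) (auto simp: cons_letter_def)

lemma free_group_simps:
  "w \<in> carrier (free_group X) \<longleftrightarrow> fst ` set w \<subseteq> X \<and> reduced_word w"
  "u \<otimes>\<^bsub>free_group X\<^esub> w = foldr cons_letter u w"
  "\<one>\<^bsub>free_group X\<^esub> = []"
  by (auto simp: free_group_def)

lemma reduced_word_rev_inv: "reduced_word u \<Longrightarrow> reduced_word (rev (map inv_letter u))"
  unfolding reduced_word_def
proof safe
  fix i assume u: "\<forall>i. Suc i < length u \<longrightarrow> u ! Suc i \<noteq> inv_letter (u ! i)"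
    and i: "Suc i < length (rev (map inv_letter u))"
    and eq: "rev (map inv_letter u) ! Suc i = inv_letter (rev (map inv_letter u) ! i)"
  define j where "j = length u - Suc (Suc i)"
  have "Suc j < length u" "length u - Suc i = Suc j"
    using i by (auto simp: j_def)
  then show False
    using u[rule_format, of j] eq i by (auto simp: rev_nth simp flip: j_def)
qed

lemma group_free_group [simp]: "group (free_group X)"
proof (rule groupI)
  fix x y assume "x \<in> carrier (free_group X)" "y \<in> carrier (free_group X)"
  then show "x \<otimes>\<^bsub>free_group X\<^esub> y \<in> carrier (free_group X)"
    using set_foldr_cons_letter[of x y] by (fastforce simp: free_group_simps foldr_cons_letter_reduced)
next
  fix x assume "x \<in> carrier (free_group X)"
  then show "\<exists>y\<in>carrier (free_group X). y \<otimes>\<^bsub>free_group X\<^esub> x = \<one>\<^bsub>free_group X\<^esub>"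
    by (intro bexI[of _ "rev (map inv_letter x)"])
       (auto simp: free_group_simps foldr_cons_letter_inverse reduced_word_rev_inv)
qed (auto simp: free_group_simps foldr_cons_letter_assoc)

lemma generator_in_free_group [simp]: "x \<in> X \<Longrightarrow> [(x, b)] \<in> carrier (free_group X)"
  by (simp add: free_group_simps)

lemma inv_generator: "x \<in> X \<Longrightarrow> inv\<^bsub>free_group X\<^esub> [(x, b)] = [(x, \<not> b)]"
  by (rule group.inv_equality) (auto simp: free_group_simps cons_letter_def)

subsection \<open>The universal property\<close>

text \<open>The value of a word in a group \<open>G\<close> when the letter \<open>x\<close> is read as \<open>f x\<close>.\<close>

definition eval_word :: "('g, 'm) monoid_scheme \<Rightarrow> ('a \<Rightarrow> 'g) \<Rightarrow> ('a \<times> bool) list \<Rightarrow> 'g" where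
  "eval_word G f w = foldr (\<lambda>l y. (if snd l then f (fst l) else inv\<^bsub>G\<^esub> f (fst l)) \<otimes>\<^bsub>G\<^esub> y) w \<one>\<^bsub>G\<^esub>"

context group
begin

lemma eval_word_Nil [simp]: "eval_word G f [] = \<one>"
  by (simp add: eval_word_def)

lemma eval_word_Cons [simp]:
  "eval_word G f (l # w) = (if snd l then f (fst l) else inv f (fst l)) \<otimes> eval_word G f w"
  by (simp add: eval_word_def)

lemma eval_word_closed [simp]:
  "f \<in> X \<rightarrow> carrier G \<Longrightarrow> fst ` set w \<subseteq> X \<Longrightarrow> eval_word G f w \<in> carrier G"
  by (induction w) auto

lemma eval_word_cons_letter:
  assumes "f \<in> X \<rightarrow> carrier G" "fst ` set (l # w) \<subseteq> X"
  shows "eval_word G f (cons_letter l w) = eval_word G f (l # w)"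
proof (cases "w \<noteq> [] \<and> hd w = inv_letter l")
  case True
  then obtain w' where [simp]: "w = inv_letter l # w'"
    by (cases w) auto
  have "f (fst l) \<in> carrier G" "eval_word G f w' \<in> carrier G"
    using assms by auto
  then show ?thesis
    by (simp add: cons_letter_def m_assoc[symmetric])
qed (auto simp: cons_letter_def)

lemma eval_word_hom:
  assumes f: "f \<in> X \<rightarrow> carrier G"
  shows "eval_word G f \<in> hom (free_group X) G"
proof (rule homI)
  fix u w assume "u \<in> carrier (free_group X)" "w \<in> carrier (free_group X)"
  then have "fst ` set u \<subseteq> X" "fst ` set w \<subseteq> X"
    by (auto simp: free_group_simps)
  then show "eval_word G f (u \<otimes>\<^bsub>free_group X\<^esub> w) = eval_word G f u \<otimes> eval_word G f w"
    unfolding free_group_simps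
  proof (induction u)
    case (Cons l u)
    have "fst ` set (foldr cons_letter u w) \<subseteq> X"
      using Cons.prems set_foldr_cons_letter[of u w] by fastforce
    moreover have "f (fst l) \<in> carrier G"
      using f Cons.prems by auto
    ultimately show ?case
      using Cons f eval_word_cons_letter[OF f] by (simp add: m_assoc)
  qed (use f in auto)
qed (use f in \<open>auto simp: free_group_simps\<close>)

lemma eval_word_generator [simp]:
  "f x \<in> carrier G \<Longrightarrow> eval_word G f [(x, True)] = f x"
  by simp

text \<open>A homomorphism out of a free group is determined by its values on the generators.\<close>

lemma free_group_hom_eq_eval_word:
  assumes h: "h \<in> hom (free_group X) G" and w: "w \<in> carrier (free_group X)"
  shows "h w = eval_word G (\<lambda>x. h [(x, True)]) w"
proof -
  interpret h: group_hom "free_group X" G h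
    using h by (simp add: group_hom_def group_hom_axioms_def group_axioms)
  show ?thesis
    using w
  proof (induction w)
    case Nil
    then show ?case
      using h.hom_one by (simp add: free_group_simps)
  next
    case (Cons l w)
    obtain x b where l: "l = (x, b)"
      by (cases l)
    with Cons have x: "x \<in> X" and w: "w \<in> carrier (free_group X)"
      by (auto simp: free_group_simps)
    have "l # w = [(x, b)] \<otimes>\<^bsub>free_group X\<^esub> w"
      using Cons.prems by (auto simp: free_group_simps cons_letter_def l)
    then have "h (l # w) = h [(x, b)] \<otimes> h w"
      using x w by simp
    moreover have "h [(x, False)] = inv h [(x, True)]"
      using x by (simp flip: h.hom_inv add: inv_generator)
    ultimately show ?case
      using Cons.IH w by (auto simp: l)
  qed
qed

end

lemma free_group_endomorphism_id:
  assumes "h \<in> hom (free_group X) (free_group X)" "\<And>x. x \<in> X \<Longrightarrow> h [(x, True)] = [(x, True)]"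
    and w: "w \<in> carrier (free_group X)"
  shows "h w = w"
proof -
  interpret group "free_group X" by simp
  have eq: "eval_word (free_group X) f w = eval_word (free_group X) g w"
    if "\<And>x. x \<in> X \<Longrightarrow> f x = g x" for f g
    using that w by (force simp: eval_word_def free_group_simps intro!: foldr_cong)
  show ?thesis
    using free_group_hom_eq_eval_word[OF assms(1) w] eq[of "\<lambda>x. h [(x, True)]" "\<lambda>x. [(x, True)]"]
      free_group_hom_eq_eval_word[OF id_iso[THEN iso_imp_homomorphism] w] assms(2)
    by simp
qed

subsection \<open>Isomorphism types and commutativity\<close>

lemma free_group_iso_bij:
  assumes "bij_betw f X Y"
  shows "free_group X \<cong> free_group Y"
proof -
  let ?f' = "inv_into X f"
  let ?h = "eval_word (free_group Y) (\<lambda>x. [(f x, True)])"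
  let ?k = "eval_word (free_group X) (\<lambda>y. [(?f' y, True)])"
  interpret X: group "free_group X" by simp
  interpret Y: group "free_group Y" by simp
  have f: "f x \<in> Y" "?f' (f x) = x" if "x \<in> X" for x
    using assms that by (auto simp: bij_betw_def)
  have f': "?f' y \<in> X" "f (?f' y) = y" if "y \<in> Y" for y
    using assms that by (auto simp: bij_betw_def inv_into_into f_inv_into_f)
  have h: "?h \<in> hom (free_group X) (free_group Y)"
    using f by (intro Y.eval_word_hom) simp
  have k: "?k \<in> hom (free_group Y) (free_group X)"
    using f' by (intro X.eval_word_hom) simp
  have "(?k \<circ> ?h) w = w" if "w \<in> carrier (free_group X)" for w
    using f f' by (intro free_group_endomorphism_id[OF hom_compose[OF h k] _ that]) simp
  moreover have "(?h \<circ> ?k) w = w" if "w \<in> carrier (free_group Y)" for w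
    using f f' by (intro free_group_endomorphism_id[OF hom_compose[OF k h] _ that]) simp
  ultimately have "group_isomorphisms (free_group X) (free_group Y) ?h ?k"
    using h k by (auto simp: group_isomorphisms_def)
  then show ?thesis
    using group_isomorphisms_imp_iso is_iso_def by blast
qed

lemma free_group_singleton: "free_group {x} \<cong> integer_group"
proof -
  let ?F = "free_group {x}"
  interpret F: group ?F by simp
  interpret Z: group integer_group by simp
  let ?h = "eval_word integer_group (\<lambda>_. 1)"
  let ?k = "\<lambda>n::int. [(x, True)] [^]\<^bsub>?F\<^esub> n"
  have h: "?h \<in> hom ?F integer_group"
    by (intro Z.eval_word_hom) auto
  then interpret h: group_hom ?F integer_group ?h
    by unfold_locales
  have k: "?k \<in> hom integer_group ?F"
    by (rule F.hom_integer_group_pow) simp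
  have "(?k \<circ> ?h) w = w" if "w \<in> carrier ?F" for w
    by (rule free_group_endomorphism_id[OF hom_compose[OF h k] _ that]) simp
  moreover have "?h (?k n) = n" for n
    by (subst h.hom_int_pow) (auto simp: group_int_pow_integer_group)
  ultimately have "group_isomorphisms ?F integer_group ?h ?k"
    using h k by (auto simp: group_isomorphisms_def)
  then show ?thesis
    using group_isomorphisms_imp_iso is_iso_def by blast
qed

lemma free_group_not_comm:
  assumes "x \<in> X" "y \<in> X" "x \<noteq> y"
  shows "\<not> comm_group (free_group X)"
proof
  assume "comm_group (free_group X)"
  then interpret comm_group "free_group X" .
  show False
    using m_comm[of "[(x, True)]" "[(y, True)]"] assms by (auto simp: free_group_simps cons_letter_def)
qed

lemma free_group_empty_comm: "comm_group (free_group {})"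
  by (rule group.group_comm_groupI) (auto simp: free_group_simps)

section \<open>Holonomy of a cocycle on an open cover\<close>

text \<open>A cover of \<open>S\<close> by open sets \<open>U v\<close> and a \<open>G\<close>-valued cocycle \<open>g\<close> that is constant on each
  overlap. The sets \<open>U v\<close> may extend beyond \<open>S\<close>; the conditions on \<open>g u v\<close> concern only indices for
  which the overlap meets \<open>S\<close>.\<close>

locale cover_cocycle = group G for G (structure) +
  fixes S :: "'s::topological_space set" and U :: "'v \<Rightarrow> 's set" and g :: "'v \<Rightarrow> 'v \<Rightarrow> 'a"
  assumes open_patch: "open (U v)"
    and patches_cover: "x \<in> S \<Longrightarrow> \<exists>v. x \<in> U v"
    and g_closed: "\<lbrakk>x \<in> S; x \<in> U u; x \<in> U v\<rbrakk> \<Longrightarrow> g u v \<in> carrier G"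
    and g_mult: "\<lbrakk>x \<in> S; x \<in> U u; x \<in> U v; x \<in> U w\<rbrakk> \<Longrightarrow> g u v \<otimes> g v w = g u w"
begin

text \<open>A flat section along \<open>f\<close> of the principal bundle that \<open>g\<close> defines, in coordinates: \<open>c z v\<close> is the
  coordinate at \<open>z\<close> over the patch \<open>U v\<close>. It is unconstrained when \<open>f z\<close> lies outside \<open>U v\<close>.\<close>

definition flat_section :: "'k::topological_space set \<Rightarrow> ('k \<Rightarrow> 's) \<Rightarrow> ('k \<Rightarrow> 'v \<Rightarrow> 'a) \<Rightarrow> bool" where
  "flat_section K f c \<longleftrightarrow>
     (\<forall>z\<in>K. \<forall>v. f z \<in> U v \<longrightarrow> c z v \<in> carrier G) \<and>
     (\<forall>z\<in>K. \<forall>u v. f z \<in> U u \<longrightarrow> f z \<in> U v \<longrightarrow> c z v = c z u \<otimes> g u v) \<and>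
     (\<forall>z\<in>K. \<forall>v. f z \<in> U v \<longrightarrow>
        (\<exists>W. open W \<and> z \<in> W \<and> (\<forall>z'\<in>K \<inter> W. f z' \<in> U v \<longrightarrow> c z' v = c z v)))"

lemma flat_sectionI:
  assumes "\<And>z v. z \<in> K \<Longrightarrow> f z \<in> U v \<Longrightarrow> c z v \<in> carrier G"
    and "\<And>z u v. z \<in> K \<Longrightarrow> f z \<in> U u \<Longrightarrow> f z \<in> U v \<Longrightarrow> c z v = c z u \<otimes> g u v"
    and "\<And>z v. z \<in> K \<Longrightarrow> f z \<in> U v \<Longrightarrow>
           \<exists>W. open W \<and> z \<in> W \<and> (\<forall>z'\<in>K \<inter> W. f z' \<in> U v \<longrightarrow> c z' v = c z v)"
  shows "flat_section K f c"
  unfolding flat_section_def by (intro conjI ballI allI impI assms)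

lemma flat_sectionD:
  assumes "flat_section K f c" "z \<in> K" "f z \<in> U v"
  shows "c z v \<in> carrier G" 
    and "f z \<in> U u \<Longrightarrow> c z v = c z u \<otimes> g u v"
    and "\<exists>W. open W \<and> z \<in> W \<and> (\<forall>z'\<in>K \<inter> W. f z' \<in> U v \<longrightarrow> c z' v = c z v)"
  using assms unfolding flat_section_def by blast+

lemma flat_section_compose:
  assumes c: "flat_section K f c" and h: "continuous_on L h" "h \<in> L \<rightarrow> K"
    and f': "\<And>z. z \<in> L \<Longrightarrow> f' z = f (h z)"
  shows "flat_section L f' (c \<circ> h)"
proof (rule flat_sectionI)
  fix z v assume z: "z \<in> L" "f' z \<in> U v"
  then have hz: "h z \<in> K" "f (h z) \<in> U v"
    using h f' by auto
  show "(c \<circ> h) z v \<in> carrier G"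
    using flat_sectionD(1)[OF c hz] by simp
  obtain W where W: "open W" "h z \<in> W" "\<forall>y\<in>K \<inter> W. f y \<in> U v \<longrightarrow> c y v = c (h z) v"
    using flat_sectionD(3)[OF c hz] by blast
  obtain T where T: "open T" "z \<in> T" "\<forall>y\<in>L. y \<in> T \<longrightarrow> h y \<in> W"
    using h(1)[unfolded continuous_on_topological, rule_format, OF z(1) W(1,2)] by blast
  then show "\<exists>T. open T \<and> z \<in> T \<and> (\<forall>y\<in>L \<inter> T. f' y \<in> U v \<longrightarrow> (c \<circ> h) y v = (c \<circ> h) z v)"
  proof (intro exI[of _ T] conjI ballI impI)
    fix y assume y: "y \<in> L \<inter> T" "f' y \<in> U v"
    then have "h y \<in> K \<inter> W" "f (h y) \<in> U v"
      using h(2) f'[of y] T by auto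
    then show "(c \<circ> h) y v = (c \<circ> h) z v"
      using W(3) by simp
  qed (rule T)+
next
  fix z u v assume "z \<in> L" "f' z \<in> U u" "f' z \<in> U v"
  then show "(c \<circ> h) z v = (c \<circ> h) z u \<otimes> g u v"
    using flat_sectionD(2)[OF c, of "h z" v u] h f' by auto
qed

lemma flat_section_mult_left:
  assumes c: "flat_section K f c" and k: "k \<in> carrier G" and f: "f \<in> K \<rightarrow> S"
  shows "flat_section K f (\<lambda>z v. k \<otimes> c z v)"
proof (rule flat_sectionI)
  fix z u v assume z: "z \<in> K" "f z \<in> U u" "f z \<in> U v"
  then have "f z \<in> S"
    using f by auto
  then show "k \<otimes> c z v = k \<otimes> c z u \<otimes> g u v"
    using flat_sectionD(1)[OF c z(1,2)] flat_sectionD(2)[OF c z(1,3,2)] z k g_closed[of "f z" u v]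
    by (simp add: m_assoc)
next
  fix z v assume "z \<in> K" "f z \<in> U v"
  then obtain W where "open W" "z \<in> W" "\<forall>y\<in>K \<inter> W. f y \<in> U v \<longrightarrow> c y v = c z v"
    using flat_sectionD(3)[OF c] by blast
  then show "\<exists>W. open W \<and> z \<in> W \<and> (\<forall>y\<in>K \<inter> W. f y \<in> U v \<longrightarrow> k \<otimes> c y v = k \<otimes> c z v)"
    by (intro exI[of _ W]) simp
qed (use flat_sectionD(1)[OF c] k in auto)

lemma flat_section_unique:
  assumes "connected K" and f: "continuous_on K f" "f \<in> K \<rightarrow> S"
    and c: "flat_section K f c" and c': "flat_section K f c'"
  obtains k where "k \<in> carrier G" "\<And>z v. z \<in> K \<Longrightarrow> f z \<in> U v \<Longrightarrow> c' z v = k \<otimes> c z v"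
proof (cases "K = {}")
  case True
  then show ?thesis
    using that by blast
next
  case False
  then obtain a where a: "a \<in> K"
    by blast
  then obtain r where r: "f a \<in> U r"
    using f(2) patches_cover by blast
  define k where "k = c' a r \<otimes> inv (c a r)"
  have k: "k \<in> carrier G"
    using flat_sectionD(1)[OF c a r] flat_sectionD(1)[OF c' a r] by (simp add: k_def)
  have change_index: "c' z v = k \<otimes> c z v"
    if z: "z \<in> K" "f z \<in> U u" "f z \<in> U v" and eq: "c' z u = k \<otimes> c z u" for z u v
  proof -
    have "f z \<in> S"
      using z f by auto
    then show ?thesis
      using flat_sectionD(1)[OF c z(1,2)] flat_sectionD(2)[OF c z(1,3,2)]
        flat_sectionD(2)[OF c' z(1,3,2)] z k eq g_closed[of "f z" u v]
      by (simp add: m_assoc)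
  qed
  have "\<forall>v. f b \<in> U v \<longrightarrow> c' b v = k \<otimes> c b v" if b: "b \<in> K" for b
  proof (rule connected_induction_simple[OF \<open>connected K\<close> a b])
    have "c' a r = k \<otimes> c a r"
      using flat_sectionD(1)[OF c a r] flat_sectionD(1)[OF c' a r] by (simp add: k_def m_assoc)
    then show "\<forall>v. f a \<in> U v \<longrightarrow> c' a v = k \<otimes> c a v"
      using change_index[OF a r] by blast
  next
    fix z assume z: "z \<in> K"
    then obtain w where w: "f z \<in> U w"
      using f(2) patches_cover by blast
    obtain W where W: "open W" "z \<in> W" "\<forall>y\<in>K \<inter> W. f y \<in> U w \<longrightarrow> c y w = c z w"
      using flat_sectionD(3)[OF c z w] by blast
    obtain W' where W': "open W'" "z \<in> W'" "\<forall>y\<in>K \<inter> W'. f y \<in> U w \<longrightarrow> c' y w = c' z w"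
      using flat_sectionD(3)[OF c' z w] by blast
    obtain T where T: "open T" "z \<in> T" "\<forall>y\<in>K. y \<in> T \<longrightarrow> f y \<in> U w"
      using f(1) z w open_patch[of w] unfolding continuous_on_topological by blast
    show "\<exists>T. openin (top_of_set K) T \<and> z \<in> T \<and> (\<forall>x\<in>T. \<forall>y\<in>T.
        (\<forall>v. f x \<in> U v \<longrightarrow> c' x v = k \<otimes> c x v) \<longrightarrow> (\<forall>v. f y \<in> U v \<longrightarrow> c' y v = k \<otimes> c y v))"
    proof (intro exI[of _ "K \<inter> (W \<inter> W' \<inter> T)"] conjI ballI impI allI)
      show "openin (top_of_set K) (K \<inter> (W \<inter> W' \<inter> T))"
        using W W' T by (intro openin_open_Int open_Int)
      show "z \<in> K \<inter> (W \<inter> W' \<inter> T)"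
        using z W W' T by simp
      fix x y v assume x: "x \<in> K \<inter> (W \<inter> W' \<inter> T)" and y: "y \<in> K \<inter> (W \<inter> W' \<inter> T)"
        and eq: "\<forall>v. f x \<in> U v \<longrightarrow> c' x v = k \<otimes> c x v" and v: "f y \<in> U v"
      have "f x \<in> U w" "f y \<in> U w"
        using x y T(3) by auto
      then have "c x w = c y w" "c' x w = c' y w"
        using x y W(3) W'(3) by auto
      then show "c' y v = k \<otimes> c y v"
        using change_index[of y w v] \<open>f x \<in> U w\<close> \<open>f y \<in> U w\<close> eq v y by auto
    qed
  qed
  then show ?thesis
    using that k by blast
qed

lemma flat_section_constant:
  assumes "\<And>z v. z \<in> K \<Longrightarrow> f z \<in> U v \<Longrightarrow> h v \<in> carrier G"
    and "\<And>z u v. z \<in> K \<Longrightarrow> f z \<in> U u \<Longrightarrow> f z \<in> U v \<Longrightarrow> h v = h u \<otimes> g u v"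
  shows "flat_section K f (\<lambda>_. h)"
proof (rule flat_sectionI)
  show "\<exists>W. open W \<and> z \<in> W \<and> (\<forall>z'\<in>K \<inter> W. f z' \<in> U v \<longrightarrow> h v = h v)" for z v
    by (rule exI[of _ UNIV]) simp
qed (rule assms; assumption)+

text \<open>Over a single patch \<open>U w\<close> the section with coordinate \<open>g w w\<close>, that is \<open>\<one>\<close>, in this patch is flat.\<close>

lemma flat_section_in_patch:
  assumes "f \<in> K \<rightarrow> S \<inter> U w"
  shows "flat_section K f (\<lambda>_. g w)"
proof (rule flat_section_constant)
  fix z u v assume "z \<in> K" "f z \<in> U u" "f z \<in> U v"
  moreover from this assms have "f z \<in> S" "f z \<in> U w"
    by auto
  ultimately show "g w v = g w u \<otimes> g u v"
    using g_mult[of "f z" w u v] by simp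
next
  fix z v assume "z \<in> K" "f z \<in> U v"
  with assms show "g w v \<in> carrier G"
    using g_closed[of "f z" w v] by auto
qed

lemma flat_section_union:
  assumes "closed A" "closed B" and AB: "connected (A \<inter> B)"
    and f: "continuous_on (A \<union> B) f" "f \<in> A \<union> B \<rightarrow> S"
    and a: "flat_section A f a" and b: "flat_section B f b"
  obtains c where "flat_section (A \<union> B) f c"
proof -
  obtain k where k: "k \<in> carrier G"
    and ab: "\<And>z v. z \<in> A \<Longrightarrow> z \<in> B \<Longrightarrow> f z \<in> U v \<Longrightarrow> a z v = k \<otimes> b z v"
  proof (rule flat_section_unique[OF AB])
    show "continuous_on (A \<inter> B) f" "f \<in> A \<inter> B \<rightarrow> S"
      using f by (auto elim: continuous_on_subset)
    show "flat_section (A \<inter> B) f b" "flat_section (A \<inter> B) f a"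
      using flat_section_compose[OF a, of "A \<inter> B" "\<lambda>z. z"] flat_section_compose[OF b, of "A \<inter> B" "\<lambda>z. z"]
      by (auto simp: o_def)
  qed blast
  \<comment> \<open>Translated by \<open>k\<close>, the section over \<open>B\<close> agrees with the one over \<open>A\<close> on the intersection.\<close>
  define b' where "b' = (\<lambda>z v. k \<otimes> b z v)"
  have b': "flat_section B f b'"
    unfolding b'_def using f(2) by (intro flat_section_mult_left[OF b k]) auto
  define c where "c z = (if z \<in> A then a z else b' z)" for z
  have cA: "c z v = a z v" if "z \<in> A" for z v
    using that by (simp add: c_def)
  have cB: "c z v = b' z v" if "z \<in> B" "f z \<in> U v" for z v
    using that ab by (simp add: c_def b'_def)
  have "flat_section (A \<union> B) f c"
  proof (rule flat_sectionI)
    fix z v assume z: "z \<in> A \<union> B" "f z \<in> U v"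
    show "c z v \<in> carrier G"
      using z flat_sectionD(1)[OF a, of z v] flat_sectionD(1)[OF b', of z v] by (auto simp: c_def)
    obtain W where W: "open W" "z \<in> W" "\<forall>y\<in>A \<inter> W. f y \<in> U v \<longrightarrow> c y v = c z v"
    proof (cases "z \<in> A")
      case True
      then show ?thesis
        using flat_sectionD(3)[OF a True z(2)] that by (auto simp: cA)
    next
      case False
      then show ?thesis
        using that[of "- A"] \<open>closed A\<close> by auto
    qed
    obtain W' where W': "open W'" "z \<in> W'" "\<forall>y\<in>B \<inter> W'. f y \<in> U v \<longrightarrow> c y v = c z v"
    proof (cases "z \<in> B")
      case True
      then show ?thesis
        using flat_sectionD(3)[OF b' True z(2)] that z by (auto simp: cB)
    next
      case False
      then show ?thesis
        using that[of "- B"] \<open>closed B\<close> by auto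
    qed
    show "\<exists>W. open W \<and> z \<in> W \<and> (\<forall>y\<in>(A \<union> B) \<inter> W. f y \<in> U v \<longrightarrow> c y v = c z v)"
      using W W' by (intro exI[of _ "W \<inter> W'"]) auto
  next
    fix z u v assume "z \<in> A \<union> B" "f z \<in> U u" "f z \<in> U v"
    then show "c z v = c z u \<otimes> g u v"
      using flat_sectionD(2)[OF a, of z v u] flat_sectionD(2)[OF b', of z v u] by (auto simp: c_def)
  qed
  then show ?thesis
    using that by blast
qed

text \<open>Flat sections on adjacent rectangles can be glued along their common side, which is connected. A
  rectangle small enough to be mapped into one patch has a flat section, and two bisections, one in
  each coordinate, pass from small rectangles to all.\<close>

lemma flat_section_exists_rectangle:
  fixes f :: "real \<times> real \<Rightarrow> 's"
  assumes f: "continuous_on UNIV f" "range f \<subseteq> S" and "a \<le> b" "a' \<le> b'"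
  shows "\<exists>c. flat_section ({a..b} \<times> {a'..b'}) f c"
proof -
  have union: "\<exists>c. flat_section (A \<union> B) f c"
    if "closed A" "closed B" "connected (A \<inter> B)" "\<exists>c. flat_section A f c" "\<exists>c. flat_section B f c" for A B
  proof -
    have "continuous_on (A \<union> B) f" "f \<in> A \<union> B \<rightarrow> S"
      using continuous_on_subset[OF f(1)] f(2) by auto
    with that show ?thesis
      using flat_section_union by metis
  qed
  define L where "L s s' t t' \<longleftrightarrow> (\<exists>c. flat_section ({s..s'} \<times> {t..t'}) f c)" for s s' t t'
  have strip: "\<exists>d>0. \<forall>s s'. s \<le> x \<and> x \<le> s' \<and> s' - s < d \<longrightarrow> L s s' t t'" if "t \<le> t'" for x t t'
    using that
  proof (induction rule: Bolzano)
    case (trans t0 t1 t2)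
    then obtain d e where "d > 0" "e > 0"
      and d: "\<And>s s'. s \<le> x \<and> x \<le> s' \<and> s' - s < d \<Longrightarrow> L s s' t0 t1"
      and e: "\<And>s s'. s \<le> x \<and> x \<le> s' \<and> s' - s < e \<Longrightarrow> L s s' t1 t2"
      by metis
    have "L s s' t0 t2" if "s \<le> x \<and> x \<le> s' \<and> s' - s < min d e" for s s'
    proof -
      have "{s..s'} \<times> {t0..t1} \<inter> {s..s'} \<times> {t1..t2} = {s..s'} \<times> {t1}"
        "{s..s'} \<times> {t0..t1} \<union> {s..s'} \<times> {t1..t2} = {s..s'} \<times> {t0..t2}"
        using trans by auto
      then show ?thesis
        using union[of "{s..s'} \<times> {t0..t1}" "{s..s'} \<times> {t1..t2}"] d[of s s'] e[of s s'] that
        by (auto simp: L_def closed_Times connected_Times)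
    qed
    then show ?case
      using \<open>d > 0\<close> \<open>e > 0\<close> by (intro exI[of _ "min d e"]) auto
  next
    case (local y)
    obtain w where "f (x, y) \<in> U w"
      using patches_cover f(2) by blast
    moreover have "open (f -` U w)"
      using f(1) open_patch by (simp add: open_vimage)
    ultimately obtain d where "d > 0" and d: "ball (x, y) d \<subseteq> f -` U w"
      by (metis openE vimageI2)
    have "L s s' t t'" if "t \<le> y \<and> y \<le> t' \<and> t' - t < d / 2" "s \<le> x \<and> x \<le> s' \<and> s' - s < d / 2" for s s' t t'
    proof -
      have "f \<in> {s..s'} \<times> {t..t'} \<rightarrow> S \<inter> U w"
      proof
        fix z assume z: "z \<in> {s..s'} \<times> {t..t'}"
        obtain z1 z2 where [simp]: "z = (z1, z2)"
          by fastforce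
        have "dist (x, y) z \<le> dist x z1 + dist y z2"
          using sqrt_sum_squares_le_sum[of "dist x z1" "dist y z2"] by (simp add: dist_Pair_Pair)
        also have "\<dots> < d"
          using z that by (auto simp: dist_real_def)
        finally show "f z \<in> S \<inter> U w"
          using d f(2) by (auto simp: subset_iff)
      qed
      then show ?thesis
        unfolding L_def using flat_section_in_patch by blast
    qed
    moreover have "d / 2 > 0"
      using \<open>d > 0\<close> by simp
    ultimately show ?case
      by blast
  qed
  have "L a b a' b'"
    using \<open>a \<le> b\<close>
  proof (induction rule: Bolzano)
    case (trans s0 s1 s2)
    have "{s0..s1} \<times> {a'..b'} \<inter> {s1..s2} \<times> {a'..b'} = {s1} \<times> {a'..b'}"
      "{s0..s1} \<times> {a'..b'} \<union> {s1..s2} \<times> {a'..b'} = {s0..s2} \<times> {a'..b'}"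
      using trans by auto
    then show ?case
      using union[of "{s0..s1} \<times> {a'..b'}" "{s1..s2} \<times> {a'..b'}"] trans
      by (auto simp: L_def closed_Times connected_Times)
  next
    case (local x)
    then show ?case
      using strip[OF \<open>a' \<le> b'\<close>, of x] by blast
  qed
  then show ?thesis
    by (simp add: L_def)
qed

lemma flat_section_exists_square:
  assumes f: "continuous_on ({0..1} \<times> {0..1}) f" "f \<in> {0..1} \<times> {0..1} \<rightarrow> S"
  obtains c where "flat_section ({0..1::real} \<times> {0..1::real}) f c"
proof -
  \<comment> \<open>The map is extended to the plane by a retraction onto the square, since the bisection
    also considers rectangles that protrude from the square.\<close>
  define clamp :: "real \<Rightarrow> real" where "clamp t = max 0 (min 1 t)" for t
  define f' where "f' z = f (clamp (fst z), clamp (snd z))" for z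
  have clamp: "clamp t \<in> {0..1}" "t \<in> {0..1} \<Longrightarrow> clamp t = t" for t
    by (auto simp: clamp_def)
  have "continuous_on UNIV f'"
    unfolding f'_def
    by (rule continuous_on_compose2[OF f(1)])
       (auto simp: clamp_def intro!: continuous_intros)
  moreover have "range f' \<subseteq> S"
    using f(2) clamp(1) by (auto simp: f'_def)
  ultimately obtain c where "flat_section ({0..1} \<times> {0..1}) f' c"
    using flat_section_exists_rectangle[of f' 0 1 0 1] by auto
  then have "flat_section ({0..1} \<times> {0..1}) f (c \<circ> (\<lambda>z. z))"
    by (rule flat_section_compose) (auto simp: f'_def clamp(2))
  then show ?thesis
    using that by blast
qed

lemma flat_section_exists_path:
  assumes p: "path_in S x y p"
  obtains c where "flat_section {0..1} p c"
proof -
  have "continuous_on ({0..1} \<times> {0..1}) (p \<circ> snd)"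
    using p by (intro continuous_intros) (auto simp: path_in_def path_def)
  moreover have "p \<circ> snd \<in> {0..1} \<times> {0..1} \<rightarrow> S"
    using p by (auto simp: path_in_def path_image_def)
  ultimately obtain c where "flat_section ({0..1::real} \<times> {0..1}) (p \<circ> snd) c"
    by (rule flat_section_exists_square)
  then have "flat_section {0..1} p (c \<circ> (\<lambda>t. (0, t)))"
    by (rule flat_section_compose) (auto intro!: continuous_intros)
  then show ?thesis
    using that by blast
qed

text \<open>Parallel transport along a path from \<open>U u\<close> to \<open>U v\<close>. By uniqueness up to left translation it does
  not depend on the flat section (\<open>transport_eq\<close>).\<close>

definition transport :: "(real \<Rightarrow> 's) \<Rightarrow> 'v \<Rightarrow> 'v \<Rightarrow> 'a" where
  "transport p u v = (let c = (SOME c. flat_section {0..1} p c) in inv (c 0 u) \<otimes> c 1 v)"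

lemma transport_eq:
  assumes p: "path_in S x y p" "x \<in> U u" "y \<in> U v" and c: "flat_section {0..1} p c"
  shows "transport p u v = inv (c 0 u) \<otimes> c 1 v"
proof -
  define c' where "c' = (SOME c. flat_section {0..1} p c)"
  have c': "flat_section {0..1} p c'"
    unfolding c'_def using c by (rule someI[of "flat_section {0..1} p"])
  have p01: "p 0 \<in> U u" "p 1 \<in> U v"
    using p by (auto simp: path_in_def pathstart_def pathfinish_def)
  obtain k where k: "k \<in> carrier G" "\<And>z v. z \<in> {0..1} \<Longrightarrow> p z \<in> U v \<Longrightarrow> c' z v = k \<otimes> c z v"
    using p(1) flat_section_unique[OF _ _ _ c c'] by (auto simp: path_in_def path_def path_image_def)
  then show ?thesis
    using flat_sectionD(1)[OF c, of 0 u] flat_sectionD(1)[OF c, of 1 v] p01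
    by (simp add: transport_def inv_mult_group m_assoc inv_solve_left' flip: c'_def)
qed

lemma transport_closed:
  assumes p: "path_in S x y p" "x \<in> U u" "y \<in> U v"
  shows "transport p u v \<in> carrier G"
proof -
  obtain c where c: "flat_section {0..1} p c"
    using flat_section_exists_path[OF p(1)] .
  then show ?thesis
    using flat_sectionD(1)[OF c, of 0 u] flat_sectionD(1)[OF c, of 1 v] p
    by (simp add: transport_eq[OF p c] path_in_def pathstart_def pathfinish_def)
qed

lemma transport_join:
  assumes p: "path_in S x y p" and q: "path_in S y z q"
    and uvw: "x \<in> U u" "y \<in> U v" "z \<in> U w"
  shows "transport (p +++ q) u w = transport p u v \<otimes> transport q v w"
proof -
  obtain c where c: "flat_section {0..1} (p +++ q) c"
    using flat_section_exists_path[OF path_in_join[OF p q]] .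
  have ends: "p 1 = y" "q 0 = y" "p 0 = x" "q 1 = z"
    using p q by (auto simp: path_in_def pathstart_def pathfinish_def)
  have "flat_section {0..1} p (c \<circ> (\<lambda>t. t / 2))"
    by (rule flat_section_compose[OF c]) (auto simp: joinpaths_def intro!: continuous_intros)
  from transport_eq[OF p uvw(1,2) this]
  have 1: "transport p u v = inv (c 0 u) \<otimes> c (1/2) v"
    by simp
  have "flat_section {0..1} q (c \<circ> (\<lambda>t. (t + 1) / 2))"
    by (rule flat_section_compose[OF c])
       (auto simp: joinpaths_def ends add_divide_distrib distrib_left intro!: continuous_intros)
  from transport_eq[OF q uvw(2,3) this]
  have 2: "transport q v w = inv (c (1/2) v) \<otimes> c 1 w"
    by simp
  have "c 0 u \<in> carrier G" "c (1/2) v \<in> carrier G" "c 1 w \<in> carrier G"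
    by (rule flat_sectionD(1)[OF c]; simp add: joinpaths_def ends uvw)+
  moreover from this have "c (1/2) v \<otimes> (inv (c (1/2) v) \<otimes> c 1 w) = c 1 w"
    by (simp flip: m_assoc)
  ultimately show ?thesis
    using transport_eq[OF path_in_join[OF p q] uvw(1,3) c] by (simp add: 1 2 m_assoc)
qed

text \<open>A flat section along the homotopy restricts to one along each path. Both of the sides along which
  the homotopy is constant have a constant coordinate, so the two paths have the same transport.\<close>

lemma transport_homotopic:
  assumes h: "homotopic_paths S p q" and p: "path_in S x y p" and q: "path_in S x y q"
    and uv: "x \<in> U u" "y \<in> U v"
  shows "transport p u v = transport q u v"
proof -
  obtain h :: "real \<times> real \<Rightarrow> 's"
    where h: "continuous_on ({0..1} \<times> {0..1}) h" "h \<in> {0..1} \<times> {0..1} \<rightarrow> S"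
    and hp: "\<forall>t\<in>{0..1}. h (0, t) = p t" and hq: "\<forall>t\<in>{0..1}. h (1, t) = q t"
    and ends: "\<forall>s\<in>{0..1}. h (s, 0) = x \<and> h (s, 1) = y"
  proof -
    from h obtain h :: "real \<times> real \<Rightarrow> 's"
      where "continuous_on ({0..1} \<times> {0..1}) h" "h \<in> {0..1} \<times> {0..1} \<rightarrow> S"
      "\<forall>t\<in>{0..1}. h (0, t) = p t" "\<forall>t\<in>{0..1}. h (1, t) = q t"
      "\<forall>s\<in>{0..1}. pathstart (h \<circ> Pair s) = pathstart p \<and> pathfinish (h \<circ> Pair s) = pathfinish p"
      unfolding homotopic_paths by blast
    with p show ?thesis
      by (intro that[of h]) (auto simp: path_in_def pathstart_def pathfinish_def)
  qed
  obtain c where c: "flat_section ({0..1} \<times> {0..1}) h c"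
    using flat_section_exists_square[OF h] .
  have side: "c (0, t) w = c (1, t) w" if t: "t \<in> {0..1}" and w: "\<And>s. s \<in> {0..1} \<Longrightarrow> h (s, t) = a" "a \<in> U w" "a \<in> S"
    for t w a
  proof -
    have c': "flat_section {0..1} (\<lambda>_. a) (c \<circ> (\<lambda>s. (s, t)))"
      by (rule flat_section_compose[OF c]) (use t w in \<open>auto intro!: continuous_intros\<close>)
    have g: "flat_section {0..1} (\<lambda>_. a) (\<lambda>_. g w)"
      using w by (intro flat_section_in_patch) auto
    obtain k where "k \<in> carrier G" "\<And>z v. z \<in> {0..1} \<Longrightarrow> a \<in> U v \<Longrightarrow> (c \<circ> (\<lambda>s. (s, t))) z v = k \<otimes> g w v"
      using flat_section_unique[OF _ _ _ g c'] w by auto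
    from this(2)[of 0 w] this(2)[of 1 w] show ?thesis
      using w by simp
  qed
  have xy: "x \<in> S" "y \<in> S"
    using p by (auto simp: path_in_def pathstart_def pathfinish_def path_image_def)
  have "flat_section {0..1} p (c \<circ> (\<lambda>t. (0, t)))"
    by (rule flat_section_compose[OF c]) (use hp in \<open>auto intro!: continuous_intros\<close>)
  moreover have "flat_section {0..1} q (c \<circ> (\<lambda>t. (1, t)))"
    by (rule flat_section_compose[OF c]) (use hq in \<open>auto intro!: continuous_intros\<close>)
  ultimately show ?thesis
    using transport_eq[OF p uv] transport_eq[OF q uv] side[of 0 x u] side[of 1 y v] ends uv xy by auto
qed

text \<open>If \<open>g\<close> is a coboundary along the whole path, transport depends on the end indices only.\<close>

lemma transport_constant:
  assumes p: "path_in S x y p" "x \<in> U u" "y \<in> U v"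
    and "\<And>t v. t \<in> {0..1} \<Longrightarrow> p t \<in> U v \<Longrightarrow> h v \<in> carrier G"
    and "\<And>t u v. t \<in> {0..1} \<Longrightarrow> p t \<in> U u \<Longrightarrow> p t \<in> U v \<Longrightarrow> h v = h u \<otimes> g u v"
  shows "transport p u v = inv (h u) \<otimes> h v"
  using transport_eq[OF p flat_section_constant] assms(4,5) by blast

lemma transport_const:
  assumes x: "x \<in> S" "x \<in> U u"
  shows "transport (\<lambda>_. x) u u = \<one>"
proof -
  have "transport (\<lambda>_. x) u u = inv (g u u) \<otimes> g u u"
    using x g_closed[of x] g_mult[of x]
    by (intro transport_constant[OF path_in_const]) auto
  then show ?thesis
    using x g_closed[of x] by simp
qed

lemma transport_reverse:
  assumes p: "path_in S x y p" "x \<in> U u" "y \<in> U v"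
  shows "transport (reversepath p) v u = inv (transport p u v)"
proof -
  obtain c where c: "flat_section {0..1} p c"
    using flat_section_exists_path[OF p(1)] .
  have "flat_section {0..1} (reversepath p) (c \<circ> (\<lambda>t. 1 - t))"
    by (rule flat_section_compose[OF c]) (auto simp: reversepath_def intro!: continuous_intros)
  then have "transport (reversepath p) v u = inv (c 1 v) \<otimes> c 0 u"
    using transport_eq[OF path_in_reverse[OF p(1)] p(3,2)] by simp
  then show ?thesis
    using flat_sectionD(1)[OF c, of 0 u] flat_sectionD(1)[OF c, of 1 v] p
    by (simp add: transport_eq[OF p c] path_in_def pathstart_def pathfinish_def inv_mult_group)
qed

end

section \<open>The realization of a graph\<close>

text \<open>The vertex \<open>v\<close> as a point of the realization.\<close>

definition vertex_point :: "'v \<Rightarrow> 'v \<Rightarrow> real" where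
  "vertex_point v = (\<lambda>w. if w = v then 1 else 0)"

text \<open>The segment from \<open>u\<close> to \<open>v\<close>.\<close>

definition edge_path :: "'v \<Rightarrow> 'v \<Rightarrow> real \<Rightarrow> 'v \<Rightarrow> real" where
  "edge_path u v t = (\<lambda>w. (1 - t) * vertex_point u w + t * vertex_point v w)"

text \<open>The segment from the point \<open>x\<close> to the vertex \<open>v\<close>.\<close>

definition to_vertex :: "('v \<Rightarrow> real) \<Rightarrow> 'v \<Rightarrow> real \<Rightarrow> 'v \<Rightarrow> real" where
  "to_vertex x v t = (\<lambda>w. (1 - t) * x w + t * vertex_point v w)"

text \<open>The points with positive barycentric coordinate at \<open>v\<close>; the open star of \<open>v\<close> is the intersection
  with the realization.\<close>

definition open_star :: "'v \<Rightarrow> ('v \<Rightarrow> real) set" where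
  "open_star v = {x. 0 < x v}"

lemma open_open_star: "open (open_star v)"
proof -
  have "open ((\<lambda>x. x v) -` {0::real<..})"
    by (intro open_vimage open_greaterThan continuous_on_product_coordinates)
  then show ?thesis
    by (simp add: open_star_def vimage_def)
qed

lemma edge_path_0 [simp]: "edge_path u v 0 = vertex_point u"
  and edge_path_1 [simp]: "edge_path u v 1 = vertex_point v"
  and edge_path_same [simp]: "edge_path v v = (\<lambda>_. vertex_point v)"
  and to_vertex_0 [simp]: "to_vertex x v 0 = x"
  and to_vertex_1 [simp]: "to_vertex x v 1 = vertex_point v"
  and to_vertex_same [simp]: "to_vertex (vertex_point v) v = (\<lambda>_. vertex_point v)"
  by (auto simp: edge_path_def to_vertex_def algebra_simps fun_eq_iff)

lemma edge_path_swap: "edge_path v u = edge_path u v \<circ> linepath 1 0"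
  by (auto simp: edge_path_def linepath_def fun_eq_iff algebra_simps)

lemma to_vertex_edge_path:
  "to_vertex (edge_path u v s) v = edge_path u v \<circ> linepath s 1"
  "to_vertex (edge_path u v s) u = edge_path u v \<circ> linepath s 0"
  by (auto simp: edge_path_def to_vertex_def linepath_def fun_eq_iff algebra_simps)

lemma edge_path_in_open_star:
  "edge_path u v t \<in> open_star w \<Longrightarrow> w = u \<or> w = v"
  by (auto simp: edge_path_def vertex_point_def open_star_def split: if_splits)

lemma vertex_point_in_open_star [simp]: "vertex_point v \<in> open_star v"
  by (simp add: vertex_point_def open_star_def)

lemma continuous_edge_path: "continuous_on T (edge_path u v)"
  unfolding edge_path_def by (intro continuous_intros)

text \<open>Simple graphs: an edge is a set of two distinct vertices. Neither finiteness nor local finiteness is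
  assumed; the realization has the topology of pointwise convergence in any case.\<close>

locale graph =
  fixes V :: "'v set" and E :: "'v set set"
  assumes edgeE: "e \<in> E \<Longrightarrow> \<exists>u\<in>V. \<exists>v\<in>V. u \<noteq> v \<and> e = {u, v}"
begin

abbreviation S :: "('v \<Rightarrow> real) set" where
  "S \<equiv> graph_realization V E"

text \<open>Equal or adjacent vertices.\<close>

definition near :: "'v \<Rightarrow> 'v \<Rightarrow> bool" where
  "near u v \<longleftrightarrow> u \<in> V \<and> v \<in> V \<and> (u = v \<or> {u, v} \<in> E)"

lemma near_sym: "near u v \<Longrightarrow> near v u"
  by (auto simp: near_def insert_commute)

lemma near_refl [simp]: "near u u \<longleftrightarrow> u \<in> V"
  by (simp add: near_def)

lemma near_edge: "{u, v} \<in> E \<Longrightarrow> near u v"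
  using edgeE[of "{u, v}"] by (auto simp: near_def doubleton_eq_iff)

text \<open>A point of the open star of \<open>v\<close> lies on an edge at \<open>v\<close>; for the point \<open>v\<close> itself the edge
  degenerates, with \<open>u = v\<close>.\<close>

lemma realization_point:
  assumes "x \<in> S" "x \<in> open_star v"
  obtains u s where "near u v" "s \<in> {0..1}" "x = edge_path u v s" "{w. x w \<noteq> 0} = {u, v}"
proof -
  have nonneg: "\<And>w. 0 \<le> x w" and total: "(\<Sum>w | x w \<noteq> 0. x w) = 1"
    and supp: "{w. x w \<noteq> 0} \<in> (\<lambda>v. {v}) ` V \<union> E"
    using assms by (auto simp: graph_realization_def)
  have v: "v \<in> {w. x w \<noteq> 0}"
    using assms by (simp add: open_star_def)
  obtain u where u: "near u v" "{w. x w \<noteq> 0} = {u, v}"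
  proof (cases "{w. x w \<noteq> 0} \<in> E")
    case True
    then obtain a b where "{w. x w \<noteq> 0} = {a, b}"
      using edgeE by meson
    then show ?thesis
      using that[of a] that[of b] v True near_edge[of a b] near_edge[of b a] by (auto simp: insert_commute)
  next
    case False
    then obtain w where "w \<in> V" "{w. x w \<noteq> 0} = {w}"
      using supp by blast
    then show ?thesis
      using that[of v] v by (metis insert_absorb2 near_refl singletonD)
  qed
  have zero: "x w = 0" if "w \<noteq> u" "w \<noteq> v" for w
    using u(2) that by blast
  have xu: "u \<noteq> v \<Longrightarrow> x u = 1 - x v" and xv: "u = v \<Longrightarrow> x v = 1"
    using total by (auto simp: u(2))
  have "x = edge_path u v (x v)"
    using zero xu xv by (auto simp: edge_path_def vertex_point_def fun_eq_iff)
  moreover have "x v \<in> {0..1}"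
    using xu xv nonneg[of u] nonneg[of v] by (cases "u = v") auto
  ultimately show ?thesis
    using that u by blast
qed

lemma realization_point_near:
  assumes "x \<in> S" "x \<in> open_star u" "x \<in> open_star v"
  shows "near u v"
proof -
  obtain w where w: "near w v" "{w. x w \<noteq> 0} = {w, v}"
    using realization_point[OF assms(1,3)] by metis
  moreover have "u \<in> {w. x w \<noteq> 0}"
    using assms by (simp add: open_star_def)
  ultimately show ?thesis
    by (auto simp: near_def)
qed

lemma realization_point_edge:
  assumes "x \<in> S" "x \<in> open_star u" "x \<in> open_star v"
    and "u \<noteq> v"
  obtains s where "s \<in> {0..1}" "x = edge_path u v s"
proof -
  obtain w s where w: "s \<in> {0..1}" "x = edge_path w v s" "{w. x w \<noteq> 0} = {w, v}"
    using realization_point[OF assms(1,3)] by metis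
  moreover have "u \<in> {w. x w \<noteq> 0}"
    using assms by (simp add: open_star_def)
  ultimately have "u = w"
    using \<open>u \<noteq> v\<close> by auto
  with w(1,2) show ?thesis
    using that by blast
qed

lemma open_star_triple:
  assumes "x \<in> S" "x \<in> open_star u" "x \<in> open_star v" "x \<in> open_star w"
  shows "u = v \<or> v = w \<or> u = w"
proof -
  obtain w' where "{w. x w \<noteq> 0} = {w', v}"
    using realization_point[OF assms(1,3)] by metis
  moreover have "u \<in> {w. x w \<noteq> 0}" "w \<in> {w. x w \<noteq> 0}"
    using assms by (auto simp: open_star_def)
  ultimately show ?thesis
    by auto
qed

lemma open_stars_cover:
  assumes "x \<in> S"
  shows "\<exists>v. x \<in> open_star v"
proof -
  have "(\<Sum>w | x w \<noteq> 0. x w) = 1"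
    using assms by (simp add: graph_realization_def)
  then obtain w where "x w \<noteq> 0"
    by fastforce
  moreover have "0 \<le> x w"
    using assms by (simp add: graph_realization_def)
  ultimately show ?thesis
    by (auto simp: open_star_def intro!: exI[of _ w])
qed

lemma edge_path_in_realization:
  assumes "near u v" "t \<in> {0..1}"
  shows "edge_path u v t \<in> S"
proof -
  let ?x = "edge_path u v t"
  consider "?x = vertex_point u" | "?x = vertex_point v" | "u \<noteq> v" "0 < t" "t < 1"
    using assms by (cases "u = v"; cases "t = 0"; cases "t = 1") auto
  then show ?thesis
  proof cases
    case 3
    then have "{w. ?x w \<noteq> 0} = {u, v}"
      by (auto simp: edge_path_def vertex_point_def)
    then show ?thesis
      using 3 assms by (auto simp: graph_realization_def near_def edge_path_def vertex_point_def)
  qed (use assms in \<open>auto simp: graph_realization_def near_def vertex_point_def\<close>)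
qed

lemma vertex_point_in_realization: "v \<in> V \<Longrightarrow> vertex_point v \<in> S"
  using edge_path_in_realization[of v v 0] by simp

lemma path_in_edge_path: "near u v \<Longrightarrow> path_in S (vertex_point u) (vertex_point v) (edge_path u v)"
  by (auto simp: path_in_def path_def path_image_def pathstart_def pathfinish_def
      edge_path_in_realization continuous_edge_path)

lemma path_in_to_vertex:
  assumes x: "x \<in> S" "x \<in> open_star v"
  shows "path_in S x (vertex_point v) (to_vertex x v)"
proof -
  obtain u s where u: "near u v" "s \<in> {0..1}" "x = edge_path u v s"
    using realization_point[OF x] by metis
  then show ?thesis
    using path_in_restrict[OF path_in_edge_path[OF u(1)] u(2), of 1] by (simp add: to_vertex_edge_path)
qed

lemma to_vertex_in_realization:
  "x \<in> S \<Longrightarrow> x \<in> open_star v \<Longrightarrow> t \<in> {0..1} \<Longrightarrow> to_vertex x v t \<in> S"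
  using path_in_to_vertex[of x v] by (auto simp: path_in_def path_image_def)

lemma homotopic_to_vertex_edge_path:
  assumes x: "x \<in> S" "x \<in> open_star u" "x \<in> open_star v"
  shows "homotopic_paths S (to_vertex x u +++ edge_path u v) (to_vertex x v)"
proof (cases "u = v")
  case True
  then show ?thesis
    using homotopic_paths_join_const[of "to_vertex x v" S] path_in_to_vertex[OF x(1,3)]
    by (simp add: path_in_def)
next
  case False
  obtain s where s: "s \<in> {0..1}" "x = edge_path u v s"
    using realization_point_edge[OF x False] .
  have "near u v"
    using realization_point_near[OF x] .
  then have "homotopic_paths S ((edge_path u v \<circ> linepath s 0) +++ (edge_path u v \<circ> linepath 0 1))
     (edge_path u v \<circ> linepath s 1)"
    using path_in_edge_path[of u v] s
    by (intro homotopic_paths_restrict_join) (auto simp: path_in_def)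
  then show ?thesis
    using s(2) by (simp add: to_vertex_edge_path)
qed

lemma homotopic_edge_path_edge_path:
  assumes "near u v" "near v w" and "u = v \<or> v = w \<or> u = w"
  shows "homotopic_paths S (edge_path u v +++ edge_path v w) (edge_path u w)"
proof -
  have uv: "path (edge_path u v)" "path_image (edge_path u v) \<subseteq> S"
    and vw: "path (edge_path v w)" "path_image (edge_path v w) \<subseteq> S"
    and ends: "pathfinish (edge_path u v) = vertex_point v" "pathstart (edge_path v w) = vertex_point v"
    using path_in_edge_path assms by (auto simp: path_in_def)
  consider "u = v" | "v = w" | "u = w"
    using assms(3) by blast
  then show ?thesis
  proof cases
    case 1
    then show ?thesis
      using homotopic_paths_const_join[OF vw] ends by simp
  next
    case 2
    then show ?thesis
      using homotopic_paths_join_const[OF uv] ends by simp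
  next
    case 3
    then show ?thesis
      using homotopic_paths_restrict_join[OF uv, of 0 1 0] by (simp flip: edge_path_swap)
  qed
qed

text \<open>The open star of \<open>v\<close> contracts to \<open>v\<close>, so a path inside it followed by the segment to \<open>v\<close> is
  homotopic to the segment from its start. The homotopy is the image of a rectangle under the
  contraction, moved along the path: the two sides of the rectangle that meet at a corner are
  exchanged for the other two.\<close>

lemma homotopic_path_to_vertex:
  assumes p: "path_in S x y p" and s: "s \<in> {0..1}" and t: "t \<in> {0..1}"
    and star: "p ` closed_segment s t \<subseteq> open_star v"
  shows "homotopic_paths S ((p \<circ> linepath s t) +++ to_vertex (p t) v) (to_vertex (p s) v)"
proof -
  define F where "F z = to_vertex (p (fst z)) v (snd z)" for z
  let ?C = "closed_segment s t \<times> {0..1::real}"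
  have sub: "closed_segment s t \<subseteq> {0..1}"
    using s t by (auto simp: closed_segment_eq_real_ivl split: if_splits)
  have pS: "p r \<in> S" if "r \<in> closed_segment s t" for r
    using p sub that by (auto simp: path_in_def path_image_def)
  have "continuous_on {0..1} p"
    using p by (simp add: path_in_def path_def)
  then have pc: "continuous_on ?C (\<lambda>z. p (fst z))"
    by (rule continuous_on_compose2) (use sub in \<open>auto intro!: continuous_on_fst\<close>)
  have cont: "continuous_on ?C F"
    unfolding F_def to_vertex_def
    by (rule continuous_on_coordinatewise_then_product, rule continuous_on_add;
        rule continuous_on_mult)
       (auto intro!: continuous_intros intro: continuous_on_product_then_coordinatewise[OF pc])
  have "homotopic_paths S (F \<circ> (linepath (s, 0) (t, 0) +++ linepath (t, 0) (t, 1)))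
      (F \<circ> (linepath (s, 0) (s, 1) +++ linepath (s, 1) (t, 1)))"
  proof (rule homotopic_paths_convex_image[OF _ cont])
    show "convex ?C"
      by (intro convex_Times) auto
    show "F \<in> ?C \<rightarrow> S"
      using pS star by (auto simp: F_def image_subset_iff intro!: to_vertex_in_realization)
    have "closed_segment z w \<subseteq> ?C" if "z \<in> ?C" "w \<in> ?C" for z w
      using that \<open>convex ?C\<close> by (simp add: closed_segment_subset)
    then show "path_image (linepath (s, 0) (t, 0) +++ linepath (t, 0) (t, 1)) \<subseteq> ?C"
      "path_image (linepath (s, 0) (s, 1) +++ linepath (s, 1) (t, 1)) \<subseteq> ?C"
      by (intro subset_path_image_join; simp)+
  qed auto
  moreover have "F \<circ> linepath (s, 0) (t, 0) = p \<circ> linepath s t"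
    "F \<circ> linepath (t, 0) (t, 1) = to_vertex (p t) v"
    "F \<circ> linepath (s, 0) (s, 1) = to_vertex (p s) v"
    "F \<circ> linepath (s, 1) (t, 1) = (\<lambda>_. vertex_point v)"
    by (auto simp: F_def linepath_def fun_eq_iff algebra_simps)
  ultimately have "homotopic_paths S ((p \<circ> linepath s t) +++ to_vertex (p t) v)
      (to_vertex (p s) v +++ (\<lambda>_. vertex_point v))"
    by (simp add: path_compose_join)
  also have "homotopic_paths S \<dots> (to_vertex (p s) v)"
    using homotopic_paths_join_const[of "to_vertex (p s) v" S] path_in_to_vertex[of "p s" v] pS[of s] star
    by (auto simp: path_in_def)
  finally show ?thesis .
qed

end

section \<open>Graphs with a spanning tree\<close>

text \<open>A rooted spanning tree given by parents; \<open>depth\<close> is the distance from the root in the tree. The set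
  \<open>chords\<close> contains each edge outside the tree in exactly one of its two orientations, and no edge of
  the tree.\<close>

locale spanning_tree = graph V E for V :: "'v set" and E :: "'v set set" +
  fixes root :: 'v and parent :: "'v \<Rightarrow> 'v" and depth :: "'v \<Rightarrow> nat" and chords :: "('v \<times> 'v) set"
  assumes root: "root \<in> V" "depth root = 0"
    and parent: "\<And>v. v \<in> V \<Longrightarrow> v \<noteq> root \<Longrightarrow> {parent v, v} \<in> E"
    and depth_parent: "\<And>v. v \<in> V \<Longrightarrow> v \<noteq> root \<Longrightarrow> depth v = Suc (depth (parent v))"
    and chord_edge: "\<And>u v. (u, v) \<in> chords \<Longrightarrow> {u, v} \<in> E"
    and chord_asym: "\<And>u v. (u, v) \<in> chords \<Longrightarrow> (v, u) \<notin> chords"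
    and chord_iff: "\<And>u v. {u, v} \<in> E \<Longrightarrow> ((u, v) \<in> chords \<or> (v, u) \<in> chords) \<longleftrightarrow>
      \<not> (v \<noteq> root \<and> u = parent v \<or> u \<noteq> root \<and> v = parent u)"
begin

lemma parent_in: "v \<in> V \<Longrightarrow> v \<noteq> root \<Longrightarrow> near (parent v) v"
  using parent near_edge by blast

text \<open>The tree has one edge less than it has vertices.\<close>

lemma cycle_rank_eq_card_chords:
  assumes "finite V"
  shows "cycle_rank V E = card chords"
proof -
  let ?T = "(\<lambda>v. {parent v, v}) ` (V - {root})" and ?C = "(\<lambda>(u, v). {u, v}) ` chords"
  have "E = ?T \<union> ?C"
  proof
    show "E \<subseteq> ?T \<union> ?C"
    proof
      fix e assume "e \<in> E"
      then obtain u v where e: "u \<in> V" "v \<in> V" "e = {u, v}"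
        using edgeE by meson
      show "e \<in> ?T \<union> ?C"
      proof (cases "(u, v) \<in> chords \<or> (v, u) \<in> chords")
        case True
        then show ?thesis
          using e by (force simp: insert_commute)
      next
        case False
        then have "v \<noteq> root \<and> u = parent v \<or> u \<noteq> root \<and> v = parent u"
          using chord_iff[of u v] e \<open>e \<in> E\<close> by auto
        then show ?thesis
          using e by (force simp: insert_commute)
      qed
    qed
  qed (use parent chord_edge in auto)
  moreover have "?T \<inter> ?C = {}"
  proof -
    have False if "v \<in> V" "v \<noteq> root" "{parent v, v} = {a, b}" "(a, b) \<in> chords" for v a b
      using that chord_iff[of a b] chord_edge[of a b] by (auto simp: doubleton_eq_iff)
    then show ?thesis
      by (auto simp: disjoint_iff)
  qed
  moreover have "inj_on (\<lambda>v. {parent v, v}) (V - {root})"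
  proof (rule inj_onI)
    fix v w assume "v \<in> V - {root}" "w \<in> V - {root}" and eq: "{parent v, v} = {parent w, w}"
    then have "depth v = Suc (depth (parent v))" "depth w = Suc (depth (parent w))"
      using depth_parent by auto
    moreover have "v = w \<or> v = parent w \<and> w = parent v"
      using eq by (auto simp: doubleton_eq_iff)
    ultimately show "v = w"
      by auto
  qed
  moreover have "inj_on (\<lambda>(u, v). {u, v}) chords"
    using chord_asym by (auto simp: inj_on_def doubleton_eq_iff)
  moreover have "chords \<subseteq> V \<times> V"
    using chord_edge near_edge by (auto simp: near_def)
  then have "finite chords"
    using assms finite_subset by blast
  ultimately have "card E = card (V - {root}) + card chords"
    using assms by (simp add: card_Un_disjoint card_image)
  then show ?thesis
    using assms root card_gt_0_iff[of V] by (auto simp: cycle_rank_def card_Diff_singleton of_nat_diff)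
qed

text \<open>The path from the root to \<open>v\<close> over \<open>n\<close> edges of the tree, in the case where \<open>n\<close> is the depth of \<open>v\<close>.\<close>

primrec ancestral_path :: "nat \<Rightarrow> 'v \<Rightarrow> real \<Rightarrow> 'v \<Rightarrow> real" where
  "ancestral_path 0 v = (\<lambda>_. vertex_point root)"
| "ancestral_path (Suc n) v = ancestral_path n (parent v) +++ edge_path (parent v) v"

text \<open>The path from the root to \<open>v\<close> in the tree.\<close>

definition tree_path :: "'v \<Rightarrow> real \<Rightarrow> 'v \<Rightarrow> real" where
  "tree_path v = ancestral_path (depth v) v"

lemma tree_path_root [simp]: "tree_path root = (\<lambda>_. vertex_point root)"
  by (simp add: tree_path_def root)

lemma tree_path_parent:
  "v \<in> V \<Longrightarrow> v \<noteq> root \<Longrightarrow> tree_path v = tree_path (parent v) +++ edge_path (parent v) v"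
  by (simp add: tree_path_def depth_parent)

lemma tree_induct [consumes 1, case_names root parent]:
  assumes "v \<in> V" "P root"
    and "\<And>v. v \<in> V \<Longrightarrow> v \<noteq> root \<Longrightarrow> parent v \<in> V \<Longrightarrow> P (parent v) \<Longrightarrow> P v"
  shows "P v"
  using \<open>v \<in> V\<close>
proof (induction "depth v" arbitrary: v rule: less_induct)
  case less
  show ?case
  proof (cases "v = root")
    case False
    then have "parent v \<in> V"
      using parent_in less.prems by (simp add: near_def)
    with less False show ?thesis
      using assms(3) depth_parent[of v] by auto
  qed (use assms in auto)
qed

lemma path_in_tree_path: "v \<in> V \<Longrightarrow> path_in S (vertex_point root) (vertex_point v) (tree_path v)"
proof (induction rule: tree_induct)
  case root
  then show ?case
    using spanning_tree_axioms vertex_point_in_realization[of root]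
    by (auto intro: path_in_const simp: spanning_tree.root)
next
  case (parent v)
  then show ?case
    using path_in_join[OF _ path_in_edge_path[OF parent_in[of v]]] by (simp add: tree_path_parent)
qed

subsection \<open>The two cocycles\<close>

abbreviation loop_group :: "(real \<Rightarrow> 'v \<Rightarrow> real) set monoid" where
  "loop_group \<equiv> fundamental_group S (vertex_point root)"

abbreviation root_class :: "(real \<Rightarrow> 'v \<Rightarrow> real) \<Rightarrow> (real \<Rightarrow> 'v \<Rightarrow> real) set" where
  "root_class \<equiv> loop_class S (vertex_point root)"

text \<open>The class of the loop through the tree to \<open>u\<close>, over the edge to \<open>v\<close>, and back through the tree.\<close>

definition edge_class :: "'v \<Rightarrow> 'v \<Rightarrow> (real \<Rightarrow> 'v \<Rightarrow> real) set" where
  "edge_class u v = root_class (sandwich (tree_path u) (edge_path u v) (tree_path v))"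

sublocale loops: group loop_group
  by (intro group_fundamental_group vertex_point_in_realization root)

lemma path_in_edge_loop:
  "near u v \<Longrightarrow> path_in S (vertex_point root) (vertex_point root)
     (sandwich (tree_path u) (edge_path u v) (tree_path v))"
  by (rule path_in_sandwich[OF path_in_tree_path path_in_edge_path path_in_tree_path])
     (auto simp: near_def)

lemma edge_class_closed [simp]: "near u v \<Longrightarrow> edge_class u v \<in> carrier loop_group"
  by (simp add: edge_class_def path_in_edge_loop)

lemma edge_class_mult:
  assumes "near u v" "near v w" "u = v \<or> v = w \<or> u = w"
  shows "edge_class u v \<otimes>\<^bsub>loop_group\<^esub> edge_class v w = edge_class u w"
proof -
  have V: "u \<in> V" "v \<in> V" "w \<in> V"
    using assms by (auto simp: near_def)
  show ?thesis
    unfolding edge_class_def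
    unfolding mult_fundamental_group[OF path_in_edge_loop[OF assms(1)] path_in_edge_loop[OF assms(2)]]
    by (intro loop_class_eqI path_in_join[OF path_in_edge_loop path_in_edge_loop] assms V
        sandwich_join_sandwich[OF path_in_tree_path path_in_edge_path path_in_tree_path
          path_in_edge_path path_in_tree_path] homotopic_edge_path_edge_path)
qed

lemma edge_class_same [simp]: "v \<in> V \<Longrightarrow> edge_class v v = \<one>\<^bsub>loop_group\<^esub>"
  using edge_class_mult[of v v v] loops.l_cancel_one[of "edge_class v v" "edge_class v v"] by simp

lemma edge_class_inv: "near u v \<Longrightarrow> edge_class v u = inv\<^bsub>loop_group\<^esub> edge_class u v"
  using edge_class_mult[of v u v] near_sym[of u v]
  by (intro loops.inv_equality[symmetric]) (auto simp: near_def)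

text \<open>Over an edge of the tree the loop runs to \<open>v\<close> and back through the tree.\<close>

lemma edge_class_parent:
  assumes v: "v \<in> V" "v \<noteq> root"
  shows "edge_class (parent v) v = \<one>\<^bsub>loop_group\<^esub>"
proof -
  note par = parent_in[OF v]
  have p: "parent v \<in> V"
    using par by (simp add: near_def)
  have "homotopic_paths S (sandwich (tree_path (parent v)) (edge_path (parent v) v) (tree_path v))
      (tree_path v +++ reversepath (tree_path v))"
    unfolding sandwich_def tree_path_parent[OF v, symmetric]
    by (subst (2) tree_path_parent[OF v], rule homotopic_paths_sym)
       (rule homotopic_assoc_path_in path_in_tree_path path_in_reverse path_in_edge_path p par v)+
  also have "homotopic_paths S \<dots> (\<lambda>_. vertex_point root)"
    using homotopic_paths_join_reverse[of "tree_path v" S] path_in_tree_path[OF v(1)]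
    by (auto simp: path_in_def)
  finally show ?thesis
    unfolding edge_class_def
    by (intro loop_class_one path_in_edge_loop par vertex_point_in_realization root)
qed

text \<open>The word for the oriented edge from \<open>u\<close> to \<open>v\<close>: a generator or its inverse for a chord, and empty
  for an edge of the tree.\<close>

definition edge_letter :: "'v \<Rightarrow> 'v \<Rightarrow> (('v \<times> 'v) \<times> bool) list" where
  "edge_letter u v = (if (u, v) \<in> chords then [((u, v), True)]
     else if (v, u) \<in> chords then [((v, u), False)] else [])"

lemma edge_letter_closed [simp]: "edge_letter u v \<in> carrier (free_group chords)"
  by (auto simp: edge_letter_def free_group_simps)

lemma edge_letter_same [simp]: "edge_letter v v = []"
  using chord_asym[of v v] by (auto simp: edge_letter_def)

lemma edge_letter_mult:
  "u = v \<or> v = w \<or> u = w \<Longrightarrow>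
    edge_letter u v \<otimes>\<^bsub>free_group chords\<^esub> edge_letter v w = edge_letter u w"
proof (elim disjE)
  assume "v = w"
  moreover have "reduced_word (edge_letter u w)"
    by (simp add: edge_letter_def)
  ultimately show ?thesis
    by (simp add: free_group_simps foldr_cons_letter_Nil)
next
  assume "u = w"
  then show ?thesis
    using chord_asym[of u v] by (simp add: free_group_simps edge_letter_def cons_letter_def)
qed (simp add: free_group_simps)

text \<open>The two cocycles on the cover by open stars.\<close>

sublocale words: cover_cocycle "free_group chords" S open_star edge_letter
  by (intro cover_cocycle.intro cover_cocycle_axioms.intro group_free_group edge_letter_mult)
     (auto simp: open_open_star open_stars_cover dest: open_star_triple)

sublocale classes: cover_cocycle loop_group S open_star edge_class
proof (intro cover_cocycle.intro loops.is_group cover_cocycle_axioms.intro)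
  fix x u v w assume x: "x \<in> S" "x \<in> open_star u" "x \<in> open_star v"
  show "edge_class u v \<in> carrier loop_group"
    using realization_point_near[OF x] by simp
  assume w: "x \<in> open_star w"
  show "edge_class u v \<otimes>\<^bsub>loop_group\<^esub> edge_class v w = edge_class u w"
    using realization_point_near[OF x] realization_point_near[OF x(1,3) w]
      open_star_triple[OF x w] by (rule edge_class_mult)
qed (auto simp: open_open_star open_stars_cover)

text \<open>The homomorphism from words in the chords to the fundamental group, called \<open>\<psi>\<close> above.\<close>

definition class_of_word :: "(('v \<times> 'v) \<times> bool) list \<Rightarrow> (real \<Rightarrow> 'v \<Rightarrow> real) set" where
  "class_of_word = eval_word loop_group (\<lambda>(u, v). edge_class u v)"

lemma edge_class_chords: "(\<lambda>(u, v). edge_class u v) \<in> chords \<rightarrow> carrier loop_group"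
  using chord_edge near_edge by auto

lemma class_of_word_hom: "class_of_word \<in> hom (free_group chords) loop_group"
  unfolding class_of_word_def by (rule loops.eval_word_hom[OF edge_class_chords])

lemma class_of_word_edge_letter:
  assumes "near u v"
  shows "class_of_word (edge_letter u v) = edge_class u v"
proof -
  consider "u = v" | "(u, v) \<in> chords" | "(v, u) \<in> chords" "(u, v) \<notin> chords" |
    "v \<noteq> root" "u = parent v" "(v, u) \<notin> chords" "(u, v) \<notin> chords" |
    "u \<noteq> root" "v = parent u" "(v, u) \<notin> chords" "(u, v) \<notin> chords"
    using assms chord_iff[of u v] by (auto simp: near_def)
  then show ?thesis
  proof cases
    case 1
    then show ?thesis
      using assms by (simp add: class_of_word_def)
  next
    case 2
    then show ?thesis
      using assms by (simp add: class_of_word_def edge_letter_def)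
  next
    case 3
    then show ?thesis
      using assms near_sym[OF assms] edge_class_inv[of v u] by (simp add: class_of_word_def edge_letter_def)
  next
    case 4
    then show ?thesis
      using assms edge_class_parent[of v] by (simp add: class_of_word_def edge_letter_def near_def)
  next
    case 5
    then show ?thesis
      using assms edge_class_parent[of u] edge_class_inv[of v u] near_sym[OF assms]
      by (simp add: class_of_word_def edge_letter_def near_def)
  qed
qed

text \<open>The tautological flat section: the part of \<open>p\<close> before time \<open>t\<close>, closed up through \<open>v\<close> and the tree.
  It is locally constant because the star of \<open>v\<close> contracts to \<open>v\<close>.\<close>

lemma flat_section_of_loop:
  assumes p: "path_in S (vertex_point root) y p"
  shows "classes.flat_section {0..1} p
     (\<lambda>t v. root_class (sandwich (p \<circ> linepath 0 t) (to_vertex (p t) v) (tree_path v)))"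
    (is "classes.flat_section _ _ ?c")
proof -
  have p0: "p 0 = vertex_point root"
    using p by (simp add: path_in_def pathstart_def)
  have pS: "p t \<in> S" if "t \<in> {0..1}" for t
    using p that by (auto simp: path_in_def path_image_def)
  have in_V: "v \<in> V" if "t \<in> {0..1}" "p t \<in> open_star v" for t v
    using realization_point_near[OF pS[OF that(1)] that(2,2)] by simp
  have sub: "path_in S (vertex_point root) (p t) (p \<circ> linepath 0 t)" if "t \<in> {0..1}" for t
    using path_in_restrict[OF p, of 0 t] that p0 by simp
  have loop: "path_in S (vertex_point root) (vertex_point root)
      (sandwich (p \<circ> linepath 0 t) (to_vertex (p t) v) (tree_path v))"
    if "t \<in> {0..1}" "p t \<in> open_star v" for t v
    using that in_V[OF that]
    by (intro path_in_sandwich[OF sub path_in_to_vertex path_in_tree_path] pS)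
  show ?thesis
  proof (rule classes.flat_sectionI)
    fix t v assume tv: "t \<in> {0..1}" "p t \<in> open_star v"
    then show "?c t v \<in> carrier loop_group"
      using loop by simp
    have "continuous_on {0..1} p"
      using p by (simp add: path_in_def path_def)
    then obtain W where W: "open W" "t \<in> W" "\<forall>s\<in>{0..1}. s \<in> W \<longrightarrow> p s \<in> open_star v"
      unfolding continuous_on_topological using open_open_star tv by meson
    obtain e where e: "e > 0" "ball t e \<subseteq> W"
      using W by (meson openE)
    have "?c s v = ?c t v" if s: "s \<in> {0..1} \<inter> ball t e" "p s \<in> open_star v" for s
    proof (rule loop_class_eqI)
      have "closed_segment t s \<subseteq> {0..1} \<inter> ball t e"
        using s tv e by (intro closed_segment_subset) (auto intro: convex_Int)
      then have "p ` closed_segment t s \<subseteq> open_star v"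
        using W(3) e(2) by auto
      then have "homotopic_paths S ((p \<circ> linepath t s) +++ to_vertex (p s) v) (to_vertex (p t) v)"
        using s tv by (intro homotopic_path_to_vertex[OF p]) auto
      moreover have "homotopic_paths S ((p \<circ> linepath 0 t) +++ (p \<circ> linepath t s)) (p \<circ> linepath 0 s)"
        using p s tv by (intro homotopic_paths_restrict_join) (auto simp: path_in_def)
      ultimately show "homotopic_paths S
        (sandwich (p \<circ> linepath 0 s) (to_vertex (p s) v) (tree_path v))
        (sandwich (p \<circ> linepath 0 t) (to_vertex (p t) v) (tree_path v))"
        using s tv in_V[OF tv] pS
        by (intro sandwich_absorb[OF sub path_in_restrict[OF p] path_in_to_vertex path_in_tree_path]) auto
    qed (use s loop in auto)
    then show "\<exists>W. open W \<and> t \<in> W \<and> (\<forall>s\<in>{0..1} \<inter> W. p s \<in> open_star v \<longrightarrow> ?c s v = ?c t v)"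
      using e(1) by (intro exI[of _ "ball t e"]) auto
  next
    fix t u v assume t: "t \<in> {0..1}" and u: "p t \<in> open_star u" and v: "p t \<in> open_star v"
    have uv: "near u v"
      using realization_point_near[OF pS[OF t] u v] .
    have "root_class (sandwich (p \<circ> linepath 0 t) (to_vertex (p t) u) (tree_path u) +++
        sandwich (tree_path u) (edge_path u v) (tree_path v)) = ?c t v"
      by (intro loop_class_eqI path_in_join[OF loop path_in_edge_loop] t u uv
           sandwich_join_sandwich[OF sub path_in_to_vertex path_in_tree_path path_in_edge_path path_in_tree_path]
           homotopic_to_vertex_edge_path pS v in_V[OF t u] in_V[OF t v])
    then show "?c t v = ?c t u \<otimes>\<^bsub>loop_group\<^esub> edge_class u v"
      by (simp add: edge_class_def mult_fundamental_group loop[OF t u] path_in_edge_loop[OF uv])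
  qed
qed

lemma transport_loop:
  assumes p: "path_in S (vertex_point root) (vertex_point root) p"
  shows "classes.transport p root root = root_class p"
proof -
  let ?r = "vertex_point root"
  have ends: "p 0 = ?r" "p 1 = ?r"
    using p by (auto simp: path_in_def pathstart_def pathfinish_def)
  have const: "reversepath (\<lambda>_. ?r) = (\<lambda>_. ?r)" "(\<lambda>_. ?r) +++ (\<lambda>_. ?r) = (\<lambda>_. ?r)"
    by (auto simp: reversepath_def joinpaths_def)
  have 0: "root_class (sandwich (p \<circ> linepath 0 0) (to_vertex (p 0) root) (tree_path root)) = \<one>\<^bsub>loop_group\<^esub>"
    by (simp add: ends sandwich_def const one_fundamental_group)
  have "root_class (p +++ (\<lambda>_. ?r)) = root_class p"
    using homotopic_paths_join_const[of p S] p root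
    by (intro loop_class_eqI path_in_join[OF p path_in_const] vertex_point_in_realization)
       (auto simp: path_in_def)
  then have 1: "root_class (sandwich (p \<circ> linepath 0 1) (to_vertex (p 1) root) (tree_path root)) = root_class p"
    by (simp add: ends sandwich_def const)
  show ?thesis
    using p by (subst classes.transport_eq[OF p _ _ flat_section_of_loop[OF p]])
      (simp_all only: 0 1 vertex_point_in_open_star, simp)
qed

subsection \<open>The isomorphism with the free group on the chords\<close>

text \<open>The homomorphism \<open>class_of_word\<close> carries flat sections for the words to flat sections for the classes,
  and so carries one transport to the other.\<close>

lemma class_of_word_transport:
  assumes p: "path_in S (vertex_point root) (vertex_point root) p"
  shows "class_of_word (words.transport p root root) = root_class p"
proof -
  interpret h: group_hom "free_group chords" loop_group class_of_word
    using class_of_word_hom by unfold_locales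
  obtain c where c: "words.flat_section {0..1} p c"
    using words.flat_section_exists_path[OF p] .
  have pS: "p t \<in> S" if "t \<in> {0..1}" for t
    using p that by (auto simp: path_in_def path_image_def)
  have "classes.flat_section {0..1} p (\<lambda>t v. class_of_word (c t v))"
  proof (rule classes.flat_sectionI)
    fix t v assume tv: "t \<in> {0..1}" "p t \<in> open_star v"
    show "class_of_word (c t v) \<in> carrier loop_group"
      using words.flat_sectionD(1)[OF c tv] by simp
    obtain W where "open W" "t \<in> W" "\<forall>s\<in>{0..1} \<inter> W. p s \<in> open_star v \<longrightarrow> c s v = c t v"
      using words.flat_sectionD(3)[OF c tv] by blast
    then show "\<exists>W. open W \<and> t \<in> W \<and> (\<forall>s\<in>{0..1} \<inter> W. p s \<in> open_star v \<longrightarrow>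
        class_of_word (c s v) = class_of_word (c t v))"
      by (intro exI[of _ W]) simp
  next
    fix t u v assume t: "t \<in> {0..1}" and u: "p t \<in> open_star u" and v: "p t \<in> open_star v"
    have "near u v"
      using realization_point_near[OF pS[OF t] u v] .
    then show "class_of_word (c t v) = class_of_word (c t u) \<otimes>\<^bsub>loop_group\<^esub> edge_class u v"
      using words.flat_sectionD(1)[OF c t u] words.flat_sectionD(2)[OF c t v u]
      by (simp add: class_of_word_edge_letter)
  qed
  moreover have "c 0 root \<in> carrier (free_group chords)" "c 1 root \<in> carrier (free_group chords)"
    using p by (auto intro!: words.flat_sectionD(1)[OF c] simp: path_in_def pathstart_def pathfinish_def)
  ultimately have "class_of_word (words.transport p root root) = classes.transport p root root"
    using words.transport_eq[OF p _ _ c, of root root] classes.transport_eq[OF p, of root root]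
    by simp
  then show ?thesis
    using transport_loop[OF p] by simp
qed

lemma transport_edge_path:
  assumes "near u v"
  shows "words.transport (edge_path u v) u v = edge_letter u v"
proof -
  have "words.transport (edge_path u v) u v = inv\<^bsub>free_group chords\<^esub> edge_letter u u \<otimes>\<^bsub>free_group chords\<^esub> edge_letter u v"
  proof (rule words.transport_constant[OF path_in_edge_path[OF assms]])
    fix t a b assume "edge_path u v t \<in> open_star a" "edge_path u v t \<in> open_star b"
    then have "a \<in> {u, v}" "b \<in> {u, v}"
      using edge_path_in_open_star by fastforce+
    then show "edge_letter u b = edge_letter u a \<otimes>\<^bsub>free_group chords\<^esub> edge_letter a b"
      by (subst edge_letter_mult) auto
  qed auto
  moreover have "inv\<^bsub>free_group chords\<^esub> edge_letter u u = \<one>\<^bsub>free_group chords\<^esub>"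
    using words.inv_one by (simp add: free_group_simps)
  ultimately show ?thesis
    by simp
qed

lemma transport_tree_path: "v \<in> V \<Longrightarrow> words.transport (tree_path v) root v = []"
proof (induction rule: tree_induct)
  case root
  then show ?case
    using words.transport_const[of "vertex_point root" root] vertex_point_in_realization[of root]
      spanning_tree_axioms
    by (simp add: free_group_simps spanning_tree.root)
next
  case (parent v)
  have "(parent v, v) \<notin> chords" "(v, parent v) \<notin> chords"
    using chord_iff[of "parent v" v] spanning_tree.parent[OF spanning_tree_axioms, of v] parent by auto
  then have "edge_letter (parent v) v = []"
    by (simp add: edge_letter_def)
  then show ?case
    using parent parent_in[of v]
      words.transport_join[OF path_in_tree_path path_in_edge_path, of "parent v" v root "parent v" v]
    by (simp add: tree_path_parent free_group_simps transport_edge_path)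
qed

lemma transport_edge_loop:
  assumes "near u v"
  shows "words.transport (sandwich (tree_path u) (edge_path u v) (tree_path v)) root root = edge_letter u v"
proof -
  have V: "u \<in> V" "v \<in> V"
    using assms by (auto simp: near_def)
  note paths = path_in_tree_path[OF V(1)] path_in_edge_path[OF assms] path_in_reverse[OF path_in_tree_path[OF V(2)]]
  have "words.transport (reversepath (tree_path v)) v root = \<one>\<^bsub>free_group chords\<^esub>"
    using words.transport_reverse[OF path_in_tree_path[OF V(2)], of root v] transport_tree_path[OF V(2)]
      words.inv_one by (simp add: free_group_simps)
  then have "words.transport (edge_path u v +++ reversepath (tree_path v)) u root = edge_letter u v"
    using words.transport_join[OF paths(2,3), of u v root] transport_edge_path[OF assms] by simp
  then show ?thesis
    using words.transport_join[OF paths(1) path_in_join[OF paths(2,3)], of root u root]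
      transport_tree_path[OF V(1)]
    by (simp add: sandwich_def free_group_simps)
qed

theorem fundamental_group_root_iso: "loop_group \<cong> free_group chords"
proof -
  define \<phi> where "\<phi> = on_classes (\<lambda>p. words.transport p root root)"
  have \<phi>: "\<phi> (root_class p) = words.transport p root root"
    if p: "path_in S (vertex_point root) (vertex_point root) p" for p
    unfolding \<phi>_def using words.transport_homotopic[OF _ p] p
    by (intro on_classes_loop_class) auto
  have hom: "\<phi> \<in> hom loop_group (free_group chords)"
    by (rule homI)
       (auto simp: carrier_fundamental_group mult_fundamental_group \<phi> path_in_join
          intro!: words.transport_closed words.transport_join)
  have "class_of_word (\<phi> x) = x" if "x \<in> carrier loop_group" for x
    using that by (auto simp: carrier_fundamental_group \<phi> class_of_word_transport)
  moreover have "(\<phi> \<circ> class_of_word) w = w" if "w \<in> carrier (free_group chords)" for w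
  proof (rule free_group_endomorphism_id[OF hom_compose[OF class_of_word_hom hom] _ that])
    fix e assume e: "e \<in> chords"
    obtain u v where uv: "e = (u, v)"
      by fastforce
    have "near u v" "edge_letter u v = [(e, True)]"
      using e chord_edge near_edge by (auto simp: uv edge_letter_def)
    then show "(\<phi> \<circ> class_of_word) [(e, True)] = [(e, True)]"
      using class_of_word_edge_letter[of u v] transport_edge_loop[of u v] \<phi>[OF path_in_edge_loop, of u v]
      by (simp add: edge_class_def)
  qed
  ultimately have "group_isomorphisms loop_group (free_group chords) \<phi> class_of_word"
    using hom class_of_word_hom by (simp add: group_isomorphisms_def)
  then show ?thesis
    using group_isomorphisms_imp_iso is_iso_def by blast
qed

theorem fundamental_group_iso_free_group:
  assumes a: "a \<in> S"
  shows "fundamental_group S a \<cong> free_group chords"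
proof -
  obtain v where v: "a \<in> open_star v"
    using open_stars_cover[OF a] by blast
  have "v \<in> V"
    using realization_point_near[OF a v v] by simp
  then have "path_in S (vertex_point root) a (tree_path v +++ reversepath (to_vertex a v))"
    by (intro path_in_join[OF path_in_tree_path path_in_reverse[OF path_in_to_vertex]] a v)
  then show ?thesis
    using fundamental_group_change_basepoint fundamental_group_root_iso iso_trans by blast
qed

end

section \<open>Cubes\<close>

text \<open>The number of coordinates in which two vertices of a cube differ, in a form suited to induction on
  lists.\<close>

definition hamming_distance :: "bool list \<Rightarrow> bool list \<Rightarrow> nat" where
  "hamming_distance u v = length (filter (\<lambda>(a, b). a \<noteq> b) (zip u v))"

lemma hamming_distance_simps [simp]:
  "hamming_distance [] [] = 0"
  "hamming_distance (a # u) (b # v) = (if a = b then 0 else 1) + hamming_distance u v"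
  by (auto simp: hamming_distance_def)

lemma hamming_distance_sym: "length u = length v \<Longrightarrow> hamming_distance u v = hamming_distance v u"
  by (induction u v rule: list_induct2) auto

lemma hamming_distance_eq_0: "length u = length v \<Longrightarrow> hamming_distance u v = 0 \<longleftrightarrow> u = v"
  by (induction u v rule: list_induct2) auto

lemma hamming_distance_eq_card:
  "length u = d \<Longrightarrow> length v = d \<Longrightarrow> card {i. i < d \<and> u ! i \<noteq> v ! i} = hamming_distance u v"
  unfolding hamming_distance_def length_filter_conv_card
  by (intro arg_cong[of _ _ card]) auto

lemma cube_edge_iff:
  "{u, v} \<in> cube_edges d \<longleftrightarrow> length u = d \<and> length v = d \<and> hamming_distance u v = 1"
proof
  assume "{u, v} \<in> cube_edges d"
  then obtain a b where "{u, v} = {a, b}" and len: "length a = d" "length b = d"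
    and "card {i. i < d \<and> a ! i \<noteq> b ! i} = 1"
    unfolding cube_edges_def cube_vertices_def by blast
  moreover from this have "hamming_distance a b = 1"
    by (simp only: hamming_distance_eq_card[OF len])
  ultimately show "length u = d \<and> length v = d \<and> hamming_distance u v = 1"
    using hamming_distance_sym[of a b] by (auto simp: doubleton_eq_iff)
next
  assume "length u = d \<and> length v = d \<and> hamming_distance u v = 1"
  then show "{u, v} \<in> cube_edges d"
    using hamming_distance_eq_card[of u d v] unfolding cube_edges_def cube_vertices_def mem_Collect_eq
    by (intro exI[of _ u] exI[of _ v]) simp
qed

text \<open>The number of coordinates that are set, which is the depth of a vertex in the spanning tree.\<close>

definition weight :: "bool list \<Rightarrow> nat" where
  "weight v = length (filter id v)"

text \<open>Clears the first coordinate that is set: the parent of a nonzero vertex in the spanning tree.\<close>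

fun lower :: "bool list \<Rightarrow> bool list" where
  "lower [] = []"
| "lower (False # v) = False # lower v"
| "lower (True # v) = False # v"

lemma weight_simps [simp]: "weight [] = 0" "weight (b # v) = (if b then 1 else 0) + weight v"
  by (auto simp: weight_def)

lemma weight_replicate [simp]: "weight (replicate d False) = 0"
  by (induction d) auto

lemma weight_adjacent:
  "length u = length v \<Longrightarrow> hamming_distance u v = 1 \<Longrightarrow> weight u = Suc (weight v) \<or> weight v = Suc (weight u)"
  by (induction u v rule: list_induct2) (auto simp: hamming_distance_eq_0 split: if_splits)

lemma length_lower [simp]: "length (lower v) = length v"
  by (induction v rule: lower.induct) auto

lemma weight_lower_le: "weight (lower v) \<le> weight v"
  by (induction v rule: lower.induct) auto

lemma lower_adjacent:
  "v \<noteq> replicate (length v) False \<Longrightarrow> hamming_distance (lower v) v = 1 \<and> weight v = Suc (weight (lower v))"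
  by (induction v rule: lower.induct) (auto simp: hamming_distance_eq_0)

text \<open>The edges outside the tree, oriented towards the larger weight.\<close>

definition cube_chords :: "nat \<Rightarrow> (bool list \<times> bool list) set" where
  "cube_chords d = {(u, v). {u, v} \<in> cube_edges d \<and> weight u < weight v \<and> u \<noteq> lower v}"

interpretation cube: spanning_tree "cube_vertices d" "cube_edges d" "replicate d False" lower weight
  "cube_chords d" for d
proof
  fix e assume "e \<in> cube_edges d"
  moreover from this obtain u v where "e = {u, v}"
    unfolding cube_edges_def by blast
  ultimately have "e = {u, v}" "length u = d" "length v = d" "hamming_distance u v = 1"
    using cube_edge_iff by auto
  moreover from this have "u \<noteq> v"
    using hamming_distance_eq_0[of u v] by auto
  ultimately show "\<exists>u\<in>cube_vertices d. \<exists>v\<in>cube_vertices d. u \<noteq> v \<and> e = {u, v}"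
    unfolding cube_vertices_def by blast
next
  fix v assume "v \<in> cube_vertices d" "v \<noteq> replicate d False"
  then show "{lower v, v} \<in> cube_edges d" "weight v = Suc (weight (lower v))"
    using lower_adjacent[of v] by (auto simp: cube_edge_iff cube_vertices_def)
next
  fix u v assume uv: "{u, v} \<in> cube_edges d"
  then have "weight u = Suc (weight v) \<or> weight v = Suc (weight u)"
    using weight_adjacent[of u v] by (auto simp: cube_edge_iff)
  moreover from this have "u = lower v \<Longrightarrow> weight u < weight v" "v = lower u \<Longrightarrow> weight v < weight u"
    using weight_lower_le[of u] weight_lower_le[of v] by auto
  moreover have "0 < weight w \<Longrightarrow> w \<noteq> replicate d False" for w
    by auto
  ultimately show "((u, v) \<in> cube_chords d \<or> (v, u) \<in> cube_chords d) \<longleftrightarrow>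
      \<not> (v \<noteq> replicate d False \<and> u = lower v \<or> u \<noteq> replicate d False \<and> v = lower u)"
    using uv unfolding cube_chords_def mem_Collect_eq case_prod_conv insert_commute[of v u]
    by (metis less_asym' not_less_zero zero_less_iff_neq_zero lessI)
qed (auto simp: cube_vertices_def cube_chords_def)

lemma finite_cube_vertices: "finite (cube_vertices d)"
  using finite_lists_length_eq[of "UNIV :: bool set" d] by (simp add: cube_vertices_def)

lemma cube_chords_altdef:
  "cube_chords d = {(u, v). length u = d \<and> length v = d \<and>
     hamming_distance u v = 1 \<and> weight u < weight v \<and> u \<noteq> lower v}"
  by (auto simp: cube_chords_def cube_edge_iff)

lemma cube_chords_0: "cube_chords 0 = {}"
  by (auto simp: cube_chords_altdef)

lemma cube_chords_1: "cube_chords 1 = {}"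
  by (auto simp: cube_chords_altdef length_Suc_conv split: if_splits)

lemma cube_chords_2: "cube_chords 2 = {([True, False], [True, True])}"
proof -
  have "(u, v) \<in> cube_chords 2 \<longleftrightarrow> u = [True, False] \<and> v = [True, True]" for u v
  proof
    assume "(u, v) \<in> cube_chords 2"
    then have "length u = Suc (Suc 0)" "length v = Suc (Suc 0)"
      by (auto simp: cube_chords_altdef)
    then obtain a b a' b' where "u = [a, b]" "v = [a', b']"
      unfolding length_Suc_conv length_0_conv by blast
    with \<open>(u, v) \<in> cube_chords 2\<close> show "u = [True, False] \<and> v = [True, True]"
      by (cases a; cases b; cases a'; cases b') (simp_all add: cube_chords_altdef)
  qed (simp add: cube_chords_altdef)
  then show ?thesis
    by auto
qed

lemma cube_chords_3: 
  "cube_chords 3 = {([True, False, False], [True, True, False]),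
     ([True, False, False], [True, False, True]), ([True, True, False], [True, True, True]),
     ([True, False, True], [True, True, True]), ([False, True, False], [False, True, True])}"
    (is "_ = ?X")
proof -
  have "(u, v) \<in> cube_chords 3 \<longleftrightarrow> (u, v) \<in> ?X" for u v
  proof
    assume uv: "(u, v) \<in> cube_chords 3"
    then have "length u = Suc (Suc (Suc 0))" "length v = Suc (Suc (Suc 0))"
      by (auto simp: cube_chords_altdef)
    then obtain a b c a' b' c' where "u = [a, b, c]" "v = [a', b', c']"
      unfolding length_Suc_conv length_0_conv by blast
    with uv show "(u, v) \<in> ?X"
      by (cases a; cases b; cases c; cases a'; cases b'; cases c') (simp_all add: cube_chords_altdef)
  qed (auto simp: cube_chords_altdef)
  then show ?thesis
    unfolding set_eq_iff split_paired_All by (intro allI)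
qed

lemma card_cube_chords_3: "card (cube_chords 3) = 5"
  by (simp add: cube_chords_3)

lemma comm_group_iso:
  assumes "comm_group H" "G \<cong> H" "group G"
  shows "comm_group G"
  using comm_group.iso_imp_comm_group[OF assms(1) group.iso_sym[OF assms(3,2)]] assms(3)
  by (simp add: group.is_monoid)

theorem proposition2p2:
  shows "cycle_rank (cube_vertices 0) (cube_edges 0) = 0
       \<and> cycle_rank (cube_vertices 1) (cube_edges 1) = 0
       \<and> cycle_rank (cube_vertices 2) (cube_edges 2) = 1
       \<and> cycle_rank (cube_vertices 3) (cube_edges 3) = 5
       \<and> (\<forall>a \<in> hypercube 2. fundamental_group (hypercube 2) a \<cong> integer_group)
       \<and> (\<forall>a \<in> hypercube 3. fundamental_group (hypercube 3) a \<cong> free_group {..<5::nat})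
       \<and> (\<forall>d \<in> {0, 1, 2}. \<forall>a \<in> hypercube d. comm_group (fundamental_group (hypercube d) a))
       \<and> (\<forall>a \<in> hypercube 3. group (fundamental_group (hypercube 3) a)
                           \<and> \<not> comm_group (fundamental_group (hypercube 3) a))"
proof (intro conjI ballI)
  have rank: "cycle_rank (cube_vertices d) (cube_edges d) = int (card (cube_chords d))" for d
    by (rule cube.cycle_rank_eq_card_chords[OF finite_cube_vertices])
  show "cycle_rank (cube_vertices 0) (cube_edges 0) = 0" "cycle_rank (cube_vertices 1) (cube_edges 1) = 0"
    "cycle_rank (cube_vertices 2) (cube_edges 2) = 1" "cycle_rank (cube_vertices 3) (cube_edges 3) = 5"
    unfolding rank by (simp_all only: cube_chords_0 cube_chords_1 cube_chords_2 card_cube_chords_3) simp_all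
  have iso: "fundamental_group (hypercube d) a \<cong> free_group (cube_chords d)" if "a \<in> hypercube d" for d a
    using cube.fundamental_group_iso_free_group that by (simp add: hypercube_def)
  have iso2: "fundamental_group (hypercube 2) a \<cong> integer_group" if "a \<in> hypercube 2" for a
    using iso_trans[OF iso[OF that, unfolded cube_chords_2] free_group_singleton] .
  have "finite (cube_chords 3)"
    using card_cube_chords_3 card.infinite by force
  then have "free_group (cube_chords 3) \<cong> free_group {..<5::nat}"
    using bij_betw_iff_card[of "cube_chords 3" "{..<5::nat}"] card_cube_chords_3 free_group_iso_bij
    by auto
  then have iso3: "fundamental_group (hypercube 3) a \<cong> free_group {..<5::nat}" if "a \<in> hypercube 3" for a
    using iso_trans[OF iso[OF that]] by blast
  show "fundamental_group (hypercube 2) a \<cong> integer_group" if "a \<in> hypercube 2" for a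
    using iso2[OF that] .
  show "fundamental_group (hypercube 3) a \<cong> free_group {..<5::nat}" if "a \<in> hypercube 3" for a
    using iso3[OF that] .
  show "comm_group (fundamental_group (hypercube d) a)" if "d \<in> {0, 1, 2}" "a \<in> hypercube d" for d a
  proof (cases "d = 2")
    case True
    then show ?thesis
      using comm_group_iso[OF abelian_integer_group iso2] group_fundamental_group that by blast
  next
    case False
    then have "cube_chords d = {}"
      using that cube_chords_0 cube_chords_1 by auto
    then show ?thesis
      using comm_group_iso[OF free_group_empty_comm] iso[OF that(2)] group_fundamental_group that by metis
  qed
  show group: "group (fundamental_group (hypercube 3) a)" if "a \<in> hypercube 3" for a
    using group_fundamental_group[OF that] .
  show "\<not> comm_group (fundamental_group (hypercube 3) a)" if a: "a \<in> hypercube 3" for a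
  proof
    assume "comm_group (fundamental_group (hypercube 3) a)"
    then have "comm_group (free_group {..<5::nat})"
      using comm_group_iso[OF _ group.iso_sym[OF group[OF a] iso3[OF a]]] by simp
    then show False
      using free_group_not_comm[of 0 "{..<5::nat}" 1] by simp
  qed
qed

end
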